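(* Let $X$ be an uncountable Polish space. For every ordinal $\lambda < \omega_1$ we have $\Phi_\lambda = \mathscr{B}_1^{\lambda+1}$, where $\Phi_0 = \mathscr{B}_1^1$ and, for $0<\lambda<\omega_1$, $\Phi_\lambda = \Phi\left(\bigcup_{\eta<\lambda}\Phi_\eta\right)$.
   Context: A function $f : X \to \mathbb{R}$ is of Baire class 1 if it is the pointwise limit of a sequence of continuous functions; $\mathcal{B}_1$ denotes the set of Baire class 1 functions on $X$. An ordinal is even if it has the form $\mu + n$ with $\mu$ limit or $0$ and $n$ an even natural number. The classes $\mathscr{B}_1^\lambda$. Consider a decreasing sequence $(F_\eta)_{\eta<\mu}$ ($\mu<\omega_1$) of closed subsets of $X$ that is continuous (for every limit ordinal $\theta<\mu$, $F_\theta = \bigcap_{\eta<\theta}F_\eta$), with $F_0 = X$, and with $\bigcap_{\eta<\mu}F_\eta = \emptyset$ if $\mu$ is limit. Put $F_\eta=\emptyset$ for $\eta \ge \mu$. Sets $A, B \subseteq X$ can be separated by the transfinite difference of this sequence if $$A \subseteq \bigcup_{\eta<\mu,\ \eta \text{ even}} F_\eta\setminus F_{\eta+1} \subseteq X \setminus B .$$ $\alpha_1(A,B)$ is the least length $\mu$ of such a sequence if one exists, and $\omega_1$ otherwise. For $f\in\mathcal{B}_1$, $\alpha_1(f) = \sup_{p<q,\ p,q\in\mathbb{Q}} \alpha_1(\{f\le p\},\{f\ge q\})$, and $\mathscr{B}_1^\lambda$ is the set of bounded $f \in \mathcal{B}_1$ with $\alpha_1(f)\le\omega^\lambda$. Pseudouniform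 convergence. For a sequence $(f_n)_{n\in\mathbb{N}}$ of real-valued functions on $X$, a closed set $F\subseteq X$ and $x\in X$ let $$\omega((f_n)_{n},x,F) = \inf_{U \ni x,\ U \text{ open}}\ \inf_{N\in\mathbb{N}}\ \sup\{|f_m(y)-f_n(y)| : n,m\ge N,\ y\in U\cap F\}.$$ For $\varepsilon>0$ let $D_{(f_n)_n,\varepsilon}(F) = \{x\in F : \omega((f_n)_n,x,F)\ge\varepsilon\}$ (a closed set). For such an operation $D$ on closed sets put $D^0(F)=F$, $D^{\theta+1}(F)=D(D^\theta(F))$, $D^\theta(F)=\bigcap_{\eta<\theta}D^\eta(F)$ for limit $\theta$; its rank $\operatorname{rk}(D)$ is the least $\theta$ with $D^\theta(X)=\emptyset$ if such $\theta$ exists, and $\omega_1$ otherwise. Let $\gamma((f_n)_{n\in\mathbb{N}}) = \sup_{\varepsilon>0}\operatorname{rk}(D_{(f_n)_n,\varepsilon})$. The sequence is pseudouniformly convergent if $\gamma((f_n)_{n\in\mathbb{N}})\le\omega$. The operation $\Phi$. For a class $\mathcal{F}$ of bounded Baire class 1 functions, $\Phi(\mathcal{F})$ is the set of bounded $f\in\mathcal{B}_1$ for which there is a sequence $(f_n)_{n\in\mathbb{N}}$ of elements of $\mathcal{F}$ with $\gamma((f_n)_{n\in\mathbb{N}})\le\omega$ and $f_n\to f$ pointwise. *)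

theory Defs
  imports "HOL-Analysis.Analysis"
begin

unbundle cardinal_syntax

section \<open>Ordinals\<close>

text \<open>
  The ordinals below \<open>\<omega>\<^sub>2\<close>, carried by the field of the cardinal \<open>\<aleph>\<^sub>2\<close>. They contain
  \<open>\<omega>\<^sub>1\<close> as an element, which is needed as the value of ranks that are not countable. All suprema
  taken below are over sets that are bounded above: either they have at most \<open>\<aleph>\<^sub>1\<close> elements
  (\<open>ord_bdd_above\<close>) or they consist of ranks, which are at most \<open>\<omega>\<^sub>1\<close> (\<open>sep_rank_le_omega1\<close>,
  \<open>deriv_rank_le_omega1\<close>).
\<close>

lemma infinite_aleph0: "infinite (Field natLeq)"
proof -
  have "Field natLeq = UNIV"
    by (auto simp: Field_def natLeq_def)
  then show ?thesis by simp
qed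

typedef ordinal = "Field (cardSuc (cardSuc natLeq))"
proof -
  have "infinite (Field (cardSuc (cardSuc natLeq)))"
    by (simp add: cardSuc_finite cardSuc_Card_order natLeq_Card_order infinite_aleph0)
  then show ?thesis
    by (metis finite.emptyI equals0I)
qed

instantiation ordinal :: linorder
begin

definition less_eq_ordinal :: "ordinal \<Rightarrow> ordinal \<Rightarrow> bool" where
  "a \<le> b \<longleftrightarrow> (Rep_ordinal a, Rep_ordinal b) \<in> cardSuc (cardSuc natLeq)"

definition less_ordinal :: "ordinal \<Rightarrow> ordinal \<Rightarrow> bool" where
  "a < b \<longleftrightarrow> a \<le> b \<and> a \<noteq> (b :: ordinal)"

lemma aleph2_Card_order: "Card_order (cardSuc (cardSuc natLeq))"
  by (simp add: cardSuc_Card_order natLeq_Card_order)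

lemma aleph2_Well_order: "Well_order (cardSuc (cardSuc natLeq))"
  using aleph2_Card_order card_order_on_well_order_on by blast

instance
proof -
  let ?r = "cardSuc (cardSuc natLeq)"
  have "Linear_order ?r"
    using aleph2_Well_order by (simp add: well_order_on_def)
  then have r: "\<forall>x\<in>Field ?r. (x, x) \<in> ?r" "trans ?r" "antisym ?r" "total_on (Field ?r) ?r"
    by (auto simp: order_on_defs refl_on_def)
  have refl: "a \<le> a" for a :: ordinal
    using r(1) Rep_ordinal by (auto simp: less_eq_ordinal_def)
  have asym: "a \<le> b \<Longrightarrow> b \<le> a \<Longrightarrow> a = b" for a b :: ordinal
    using r(3) by (metis less_eq_ordinal_def antisym_def Rep_ordinal_inject)
  show "OFCLASS(ordinal, linorder_class)"
  proof
    fix a b c :: ordinal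
    show "a \<le> a" by (fact refl)
    show "(a < b) = (a \<le> b \<and> \<not> b \<le> a)"
      using asym refl by (auto simp: less_ordinal_def)
    show "a \<le> b \<Longrightarrow> b \<le> a \<Longrightarrow> a = b" by (fact asym)
    show "a \<le> b \<Longrightarrow> b \<le> c \<Longrightarrow> a \<le> c"
      using r(2) by (auto simp: less_eq_ordinal_def trans_def)
    show "a \<le> b \<or> b \<le> a"
      using r(4) refl Rep_ordinal
      by (metis Rep_ordinal_inject less_eq_ordinal_def total_on_def)
  qed
qed

end

lemma wf_less_ordinal: "wf {(a :: ordinal, b). a < b}"
proof -
  have "wf (cardSuc (cardSuc natLeq) - Id)"
    using aleph2_Well_order by (simp add: well_order_on_def)
  then have "wf (inv_image (cardSuc (cardSuc natLeq) - Id) Rep_ordinal)"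
    by (rule wf_inv_image)
  moreover have "{(a :: ordinal, b). a < b} \<subseteq> inv_image (cardSuc (cardSuc natLeq) - Id) Rep_ordinal"
    by (auto simp: less_ordinal_def less_eq_ordinal_def Rep_ordinal_inject)
  ultimately show ?thesis
    by (rule wf_subset)
qed

instance ordinal :: wellorder
proof (rule wf_wellorderI)
  show "wf {(x :: ordinal, y). x < y}" by (fact wf_less_ordinal)
  show "OFCLASS(ordinal, linorder_class)" ..
qed

lemma ord_bdd_above:
  fixes A :: "ordinal set"
  assumes "|A| \<le>o cardSuc natLeq"
  shows "bdd_above A"
proof (rule ccontr)
  let ?r = "cardSuc (cardSuc natLeq)"
  assume unb: "\<not> bdd_above A"
  have inf: "\<not> finite (Field (cardSuc natLeq))"
    by (simp add: cardSuc_finite natLeq_Card_order infinite_aleph0)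
  have reg: "regularCard ?r"
    by (intro infinite_cardSuc_regularCard inf cardSuc_Card_order natLeq_Card_order)
  have "cofinal (Rep_ordinal ` A) ?r"
    unfolding cofinal_def
  proof
    fix x assume "x \<in> Field ?r"
    then obtain a where a: "x = Rep_ordinal a"
      by (metis Rep_ordinal_cases)
    obtain b where "b \<in> A" "a < b"
      using unb unfolding bdd_above_def by (meson not_le)
    then show "\<exists>y\<in>Rep_ordinal ` A. x \<noteq> y \<and> (x, y) \<in> ?r"
      by (auto simp: a less_ordinal_def less_eq_ordinal_def Rep_ordinal_inject)
  qed
  moreover have "Rep_ordinal ` A \<subseteq> Field ?r"
    using Rep_ordinal by auto
  ultimately have 1: "|Rep_ordinal ` A| =o ?r"
    using reg unfolding regularCard_def by blast
  have "|Rep_ordinal ` A| \<le>o cardSuc natLeq"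
    using card_of_image assms ordLeq_transitive by blast
  also have "cardSuc natLeq <o ?r"
    by (intro cardSuc_greater cardSuc_Card_order natLeq_Card_order)
  finally have "|Rep_ordinal ` A| <o ?r" .
  with 1 show False
    using not_ordLess_ordIso by blast
qed

lemma ord_bdd_above_countable: "countable A \<Longrightarrow> bdd_above (A :: ordinal set)"
proof (rule ord_bdd_above)
  assume "countable A"
  then have "|A| \<le>o |UNIV :: nat set|"
    unfolding countable_def using card_of_ordLeq[of A "UNIV :: nat set"] by blast
  also have "|UNIV :: nat set| =o natLeq"
    by (rule card_of_nat)
  also have "natLeq \<le>o cardSuc natLeq"
    by (intro cardSuc_ordLeq natLeq_Card_order)
  finally show "|A| \<le>o cardSuc natLeq" .
qed

lemma ord_no_max: "\<exists>b. a < (b :: ordinal)"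
proof -
  let ?r = "cardSuc (cardSuc natLeq)"
  have "\<not> finite (Field ?r)"
    by (simp add: cardSuc_finite cardSuc_Card_order natLeq_Card_order infinite_aleph0)
  from infinite_Card_order_limit[OF aleph2_Card_order this Rep_ordinal[of a]]
  obtain b where "b \<in> Field ?r" "Rep_ordinal a \<noteq> b" "(Rep_ordinal a, b) \<in> ?r"
    by blast
  then have "a < Abs_ordinal b"
    by (metis Abs_ordinal_inverse less_eq_ordinal_def less_ordinal_def)
  then show ?thesis ..
qed

instantiation ordinal :: conditionally_complete_linorder
begin

definition inf_ordinal :: "ordinal \<Rightarrow> ordinal \<Rightarrow> ordinal" where "inf_ordinal = min"
definition sup_ordinal :: "ordinal \<Rightarrow> ordinal \<Rightarrow> ordinal" where "sup_ordinal = max"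
definition Inf_ordinal :: "ordinal set \<Rightarrow> ordinal" where "Inf (A :: ordinal set) = (LEAST a. a \<in> A)"
definition Sup_ordinal :: "ordinal set \<Rightarrow> ordinal" where "Sup (A :: ordinal set) = (LEAST b. \<forall>a\<in>A. a \<le> b)"

instance
proof
  fix X :: "ordinal set" and x y z :: ordinal
  show "x \<in> X \<Longrightarrow> bdd_below X \<Longrightarrow> Inf X \<le> x"
    by (auto simp: Inf_ordinal_def intro: Least_le)
  show "X \<noteq> {} \<Longrightarrow> (\<And>x. x \<in> X \<Longrightarrow> z \<le> x) \<Longrightarrow> z \<le> Inf X"
    unfolding Inf_ordinal_def by (metis LeastI ex_in_conv)
  show "x \<le> Sup X" if X: "x \<in> X" "bdd_above X"
  proof -
    obtain b where "\<forall>a\<in>X. a \<le> b"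
      using X(2) by (auto simp: bdd_above_def)
    then have "\<forall>a\<in>X. a \<le> Sup X"
      unfolding Sup_ordinal_def by (rule LeastI)
    then show ?thesis using X(1) by blast
  qed
  show "X \<noteq> {} \<Longrightarrow> (\<And>x. x \<in> X \<Longrightarrow> x \<le> z) \<Longrightarrow> Sup X \<le> z"
    unfolding Sup_ordinal_def by (rule Least_le) blast
qed (auto simp: inf_ordinal_def sup_ordinal_def)

end

instantiation ordinal :: "{zero, one, order_bot}"
begin

definition bot_ordinal :: ordinal where "bot_ordinal = (LEAST a. True)"
definition zero_ordinal :: ordinal where "zero_ordinal = bot"
definition one_ordinal :: ordinal where "one_ordinal = (LEAST a. 0 < a)"

instance
  by standard (simp add: bot_ordinal_def Least_le)

end

lemma ord_zero_le [simp]: "0 \<le> (a :: ordinal)"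
  by (simp add: zero_ordinal_def)

lemma ord_not_less_zero [simp]: "\<not> a < (0 :: ordinal)"
  by (simp add: not_less)

lemma ord_zero_less_iff: "0 < a \<longleftrightarrow> a \<noteq> (0 :: ordinal)"
  by (metis ord_zero_le order_less_le)

definition osucc :: "ordinal \<Rightarrow> ordinal" where
  "osucc a = (LEAST b. a < b)"

definition is_limit :: "ordinal \<Rightarrow> bool" where
  "is_limit a \<longleftrightarrow> a \<noteq> 0 \<and> (\<forall>b<a. osucc b < a)"

lemma less_osucc [simp]: "a < osucc a"
  unfolding osucc_def by (rule LeastI_ex[OF ord_no_max])

lemma osucc_le_iff: "osucc a \<le> b \<longleftrightarrow> a < b"
  by (metis Least_le less_le_trans less_osucc osucc_def)

lemma less_osucc_iff: "a < osucc b \<longleftrightarrow> a \<le> b"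
  by (meson not_le osucc_le_iff)

lemma osucc_inject [simp]: "osucc a = osucc b \<longleftrightarrow> a = b"
  by (metis less_osucc less_osucc_iff order_antisym)

lemma osucc_neq_zero [simp]: "osucc a \<noteq> 0" "0 \<noteq> osucc a"
  by (metis less_osucc ord_not_less_zero)+

lemma not_is_limit_zero [simp]: "\<not> is_limit 0"
  by (simp add: is_limit_def)

lemma not_is_limit_osucc [simp]: "\<not> is_limit (osucc a)"
  using less_osucc[of a] unfolding is_limit_def by (metis less_irrefl)

lemma one_eq_osucc: "(1 :: ordinal) = osucc 0"
  by (simp add: one_ordinal_def osucc_def)

lemma ord_cases:
  obtains "a = 0" | b where "a = osucc b" | "is_limit a"
proof -
  have "a = 0 \<or> (\<exists>b. a = osucc b) \<or> is_limit a"
  proof (cases "\<exists>b<a. \<not> osucc b < a")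
    case True
    then obtain b where "b < a" "a \<le> osucc b" by (auto simp: not_less)
    then have "a = osucc b" by (simp add: osucc_le_iff order_antisym)
    then show ?thesis by blast
  qed (auto simp: is_limit_def)
  then show thesis using that by blast
qed

lemma wf_snd_less_ordinal: "wf {((a, b :: ordinal), c, d). b < d}"
  by (rule wf_subset[OF wf_inv_image[OF wf_less_ordinal, where f = snd]]) (auto simp: inv_image_def)

instantiation ordinal :: "{plus, times}"
begin

function plus_ordinal :: "ordinal \<Rightarrow> ordinal \<Rightarrow> ordinal" where
  "plus_ordinal a 0 = a"
| "plus_ordinal a (osucc b) = osucc (plus_ordinal a b)"
| "is_limit b \<Longrightarrow> plus_ordinal a b = (SUP c\<in>{..<b}. plus_ordinal a c)"
  apply auto
  apply (metis ord_cases)+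
  done
termination
  by (relation "{((a, b :: ordinal), c, d). b < d}") (auto simp: wf_snd_less_ordinal)

function times_ordinal :: "ordinal \<Rightarrow> ordinal \<Rightarrow> ordinal" where
  "times_ordinal a 0 = 0"
| "times_ordinal a (osucc b) = times_ordinal a b + a"
| "is_limit b \<Longrightarrow> times_ordinal a b = (SUP c\<in>{..<b}. times_ordinal a c)"
  apply auto
  apply (metis ord_cases)+
  done
termination
  by (relation "{((a, b :: ordinal), c, d). b < d}") (auto simp: wf_snd_less_ordinal)

instance ..

end

text \<open>
  The limit clause is the usual one for bases \<open>a \<ge> 1\<close>; only \<open>a = \<omega>\<close> is used.
\<close>

function opow :: "ordinal \<Rightarrow> ordinal \<Rightarrow> ordinal"  (infixr "^\<^sub>o" 80) where
  "a ^\<^sub>o 0 = 1"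
| "a ^\<^sub>o (osucc b) = (a ^\<^sub>o b) * a"
| "is_limit b \<Longrightarrow> a ^\<^sub>o b = (SUP c\<in>{..<b}. a ^\<^sub>o c)"
  apply auto
  apply (metis ord_cases)+
  done
termination
  by (relation "{((a, b :: ordinal), c, d). b < d}") (auto simp: wf_snd_less_ordinal)

lemma osucc_eq_plus_1: "osucc a = a + 1"
  by (simp add: one_eq_osucc)

definition ord_of_nat :: "nat \<Rightarrow> ordinal" where
  "ord_of_nat n = (osucc ^^ n) 0"

definition ord_even :: "ordinal \<Rightarrow> bool" where
  "ord_even a \<longleftrightarrow> (\<exists>b n. (b = 0 \<or> is_limit b) \<and> even n \<and> a = b + ord_of_nat n)"

definition omega :: ordinal where
  "omega = (LEAST a. is_limit a)"

definition omega1 :: ordinal where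
  "omega1 = (LEAST a. uncountable {..<a})"

lemma uncountable_below_omega1: "uncountable {..<omega1}"
proof -
  let ?r = "cardSuc (cardSuc natLeq)"
  have "cardSuc natLeq <o ?r"
    by (intro cardSuc_greater cardSuc_Card_order natLeq_Card_order)
  then obtain x where x: "x \<in> Field ?r" "cardSuc natLeq =o Restr ?r (underS ?r x)"
    using ordLess_iff_ordIso_Restr aleph2_Well_order cardSuc_Well_order natLeq_Card_order by blast
  have sub: "Field (Restr ?r (underS ?r x)) \<subseteq> Rep_ordinal ` {..<Abs_ordinal x}"
  proof
    fix y assume "y \<in> Field (Restr ?r (underS ?r x))"
    then have "y \<noteq> x" "(y, x) \<in> ?r" "y \<in> Field ?r"
      by (auto simp: Field_def underS_def)
    then have "Abs_ordinal y < Abs_ordinal x"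
      using x(1) by (simp add: less_ordinal_def less_eq_ordinal_def Abs_ordinal_inverse Abs_ordinal_inject)
    then show "y \<in> Rep_ordinal ` {..<Abs_ordinal x}"
      using \<open>y \<in> Field ?r\<close> by (metis Abs_ordinal_inverse imageI lessThan_iff)
  qed
  have "uncountable {..<Abs_ordinal x}"
  proof
    assume "countable {..<Abs_ordinal x}"
    then have "countable (Field (Restr ?r (underS ?r x)))"
      using sub by (meson countable_image countable_subset)
    moreover obtain f where "bij_betw f (Field (cardSuc natLeq)) (Field (Restr ?r (underS ?r x)))"
      using x(2) unfolding ordIso_def iso_def by auto
    ultimately have "countable (Field (cardSuc natLeq))"
      by (metis bij_betw_imp_inj_on bij_betw_imp_surj_on countable_image_inj_on)
    then have "|Field (cardSuc natLeq)| \<le>o |UNIV :: nat set|"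
      unfolding countable_def
      using card_of_ordLeq[of "Field (cardSuc natLeq)" "UNIV :: nat set"] by blast
    then have "|Field (cardSuc natLeq)| \<le>o natLeq"
      using card_of_nat ordLeq_ordIso_trans by blast
    moreover have "|Field (cardSuc natLeq)| =o cardSuc natLeq"
      by (intro card_of_Field_ordIso cardSuc_Card_order natLeq_Card_order)
    ultimately have "cardSuc natLeq \<le>o natLeq"
      using ordIso_ordLeq_trans ordIso_symmetric by blast
    then show False
      using cardSuc_greater[OF natLeq_Card_order] not_ordLess_ordLeq by blast
  qed
  then show ?thesis
    unfolding omega1_def by (rule LeastI)
qed

lemma less_omega1_iff: "a < omega1 \<longleftrightarrow> countable {..<a}"
proof
  show "a < omega1 \<Longrightarrow> countable {..<a}"
    unfolding omega1_def using not_less_Least by blast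
  show "countable {..<a} \<Longrightarrow> a < omega1"
    using uncountable_below_omega1
    by (metis countable_subset lessThan_subset_iff not_le)
qed

lemma is_limit_omega1: "is_limit omega1"
proof -
  have "osucc b < omega1" if "b < omega1" for b
  proof -
    have "{..<osucc b} = insert b {..<b}"
      by (auto simp: less_osucc_iff)
    then show ?thesis
      using that by (simp add: less_omega1_iff)
  qed
  moreover have "omega1 \<noteq> 0"
    using uncountable_below_omega1 by (metis countable_empty lessThan_iff ord_not_less_zero equals0I)
  ultimately show ?thesis by (simp add: is_limit_def)
qed

lemma is_limit_omega: "is_limit omega"
  unfolding omega_def using is_limit_omega1 by (rule LeastI)


unbundle no cardinal_syntax

section \<open>Baire class 1 functions and the separation rank\<close>

definition baire1 :: "('a::topological_space \<Rightarrow> real) \<Rightarrow> bool" where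
  "baire1 f \<longleftrightarrow>
    (\<exists>g. (\<forall>n::nat. continuous_on UNIV (g n)) \<and> (\<forall>x. (\<lambda>n. g n x) \<longlonglongrightarrow> f x))"

text \<open>
  A sequence of length \<open>\<mu>\<close> is a function on all ordinals that is empty from \<open>\<mu>\<close> on. The sequence is
  decreasing in the weak sense.
\<close>

definition diff_seq :: "ordinal \<Rightarrow> (ordinal \<Rightarrow> 'a::topological_space set) \<Rightarrow> bool" where
  "diff_seq \<mu> F \<longleftrightarrow>
     \<mu> < omega1 \<and>
     (\<forall>\<eta><\<mu>. closed (F \<eta>)) \<and>
     (\<forall>\<zeta><\<mu>. \<forall>\<eta>\<le>\<zeta>. F \<zeta> \<subseteq> F \<eta>) \<and>
     (\<forall>\<theta><\<mu>. is_limit \<theta> \<longrightarrow> F \<theta> = (\<Inter>\<eta>\<in>{..<\<theta>}. F \<eta>)) \<and>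
     F 0 = UNIV \<and>
     (is_limit \<mu> \<longrightarrow> (\<Inter>\<eta>\<in>{..<\<mu>}. F \<eta>) = {}) \<and>
     (\<forall>\<eta>\<ge>\<mu>. F \<eta> = {})"

definition separates :: "ordinal \<Rightarrow> (ordinal \<Rightarrow> 'a set) \<Rightarrow> 'a set \<Rightarrow> 'a set \<Rightarrow> bool" where
  "separates \<mu> F A B \<longleftrightarrow>
     A \<subseteq> (\<Union>\<eta>\<in>{\<eta>. \<eta> < \<mu> \<and> ord_even \<eta>}. F \<eta> - F (osucc \<eta>)) \<and>
     (\<Union>\<eta>\<in>{\<eta>. \<eta> < \<mu> \<and> ord_even \<eta>}. F \<eta> - F (osucc \<eta>)) \<subseteq> - B"

definition sep_rank :: "'a::topological_space set \<Rightarrow> 'a set \<Rightarrow> ordinal" where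
  "sep_rank A B =
    (if \<exists>\<mu> F. diff_seq \<mu> F \<and> separates \<mu> F A B
     then (LEAST \<mu>. \<exists>F. diff_seq \<mu> F \<and> separates \<mu> F A B)
     else omega1)"

lemma sep_rank_le_omega1: "sep_rank A B \<le> omega1"
proof (cases "\<exists>\<mu> F. diff_seq \<mu> F \<and> separates \<mu> F A B")
  case True
  then obtain \<mu> F where F: "diff_seq \<mu> F" "separates \<mu> F A B" by blast
  then have "(LEAST \<mu>. \<exists>F. diff_seq \<mu> F \<and> separates \<mu> F A B) \<le> \<mu>"
    by (intro Least_le) blast
  also have "\<mu> \<le> omega1"
    using F(1) unfolding diff_seq_def by (simp add: less_imp_le)
  finally show ?thesis
    using True by (simp add: sep_rank_def)
qed (auto simp: sep_rank_def)

definition alpha1 :: "('a::topological_space \<Rightarrow> real) \<Rightarrow> ordinal" where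
  "alpha1 f =
    (SUP (p, q)\<in>{(p :: rat, q :: rat). p < q}.
       sep_rank {x. f x \<le> of_rat p} {x. f x \<ge> of_rat q})"

definition bounded_baire1 :: "ordinal \<Rightarrow> ('a::topological_space \<Rightarrow> real) set" where
  "bounded_baire1 l = {f. baire1 f \<and> bounded (range f) \<and> alpha1 f \<le> omega ^\<^sub>o l}"


section \<open>Pseudouniform convergence\<close>

text \<open>
  The supremum is taken in \<open>[0, \<infinity>]\<close>, since the differences may be unbounded.
\<close>

definition osc :: "(nat \<Rightarrow> 'a::topological_space \<Rightarrow> real) \<Rightarrow> 'a \<Rightarrow> 'a set \<Rightarrow> ennreal" where
  "osc f x F =
    (INF U\<in>{U. open U \<and> x \<in> U}. INF N.
       SUP (m, n, y)\<in>{N..} \<times> {N..} \<times> (U \<inter> F). ennreal \<bar>f m y - f n y\<bar>)"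

definition osc_deriv :: "(nat \<Rightarrow> 'a::topological_space \<Rightarrow> real) \<Rightarrow> real \<Rightarrow> 'a set \<Rightarrow> 'a set" where
  "osc_deriv f \<epsilon> F = {x \<in> F. osc f x F \<ge> ennreal \<epsilon>}"

function iter_deriv :: "('a set \<Rightarrow> 'a set) \<Rightarrow> ordinal \<Rightarrow> 'a set \<Rightarrow> 'a set" where
  "iter_deriv D 0 F = F"
| "iter_deriv D (osucc \<theta>) F = D (iter_deriv D \<theta> F)"
| "is_limit \<theta> \<Longrightarrow> iter_deriv D \<theta> F = (\<Inter>\<eta>\<in>{..<\<theta>}. iter_deriv D \<eta> F)"
  apply auto
  apply (metis ord_cases)+
  done
termination
  by (relation "inv_image {(a :: ordinal, b). a < b} (\<lambda>(D, \<theta>, F). \<theta>)")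
    (auto intro!: wf_inv_image wf_less_ordinal)

text \<open>
  Requiring \<open>\<theta> < \<omega>\<^sub>1\<close> excludes nothing: in a second countable space a decreasing transfinite sequence
  of closed sets is constant from some countable stage on.
\<close>

definition deriv_rank :: "('a set \<Rightarrow> 'a set) \<Rightarrow> ordinal" where
  "deriv_rank D =
    (if \<exists>\<theta><omega1. iter_deriv D \<theta> UNIV = {}
     then (LEAST \<theta>. iter_deriv D \<theta> UNIV = {})
     else omega1)"

lemma deriv_rank_le_omega1: "deriv_rank D \<le> omega1"
proof (cases "\<exists>\<theta><omega1. iter_deriv D \<theta> UNIV = {}")
  case True
  then obtain \<theta> where \<theta>: "\<theta> < omega1" "iter_deriv D \<theta> UNIV = {}" by blast
  have "(LEAST \<theta>. iter_deriv D \<theta> UNIV = {}) \<le> \<theta>"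
    using \<theta>(2) by (rule Least_le)
  then show ?thesis
    using \<theta>(1) True by (simp add: deriv_rank_def)
qed (auto simp: deriv_rank_def)

definition gamma_rank :: "(nat \<Rightarrow> 'a::topological_space \<Rightarrow> real) \<Rightarrow> ordinal" where
  "gamma_rank f = (SUP \<epsilon>\<in>{0<..}. deriv_rank (osc_deriv f \<epsilon>))"

definition pseudouniformly_convergent :: "(nat \<Rightarrow> 'a::topological_space \<Rightarrow> real) \<Rightarrow> bool" where
  "pseudouniformly_convergent f \<longleftrightarrow> gamma_rank f \<le> omega"

definition Phi :: "('a::topological_space \<Rightarrow> real) set \<Rightarrow> ('a \<Rightarrow> real) set" where
  "Phi \<F> =
    {f. baire1 f \<and> bounded (range f) \<and>
        (\<exists>g. (\<forall>n. g n \<in> \<F>) \<and> pseudouniformly_convergent g \<and> (\<forall>x. (\<lambda>n. g n x) \<longlonglongrightarrow> f x))}"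

function Phi_level :: "ordinal \<Rightarrow> ('a::topological_space \<Rightarrow> real) set" where
  "Phi_level l =
    (if l = 0 then bounded_baire1 1 else Phi (\<Union>\<eta>\<in>{..<l}. Phi_level \<eta>))"
  by auto
termination
  by (relation "{(a :: ordinal, b). a < b}") (auto simp: wf_less_ordinal)

declare Phi_level.simps [simp del]

end

theory Submission
  imports Defs
begin

text \<open>
  A countable decreasing sequence of closed sets, continuous at limits, is the same as an upper
  semicontinuous ordinal-valued rank function. A bounded function has class \<open>\<lambda> > 0\<close> exactly when it
  is a uniform limit of functions that are locally constant on the level sets of a rank function with
  values below \<open>\<omega>\<^sup>\<lambda>\<close>; such functions are closed under finite combinations because \<open>\<omega>\<^sup>\<lambda>\<close> is closed under
  natural sums.

  If \<open>f\<close> is a pseudouniform limit of functions of class \<open>\<lambda>\<close>, then locally on each difference of the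
  derivatives of the sequence \<open>f\<close> is uniformly close to one member of the sequence, so each of the
  \<open>\<omega>\<close> many steps costs at most \<open>\<omega>\<^sup>\<lambda>\<close> steps of the separating sequence for \<open>f\<close>. Conversely, a rank below \<open>\<omega>\<^sup>\<lambda>\<^sup>+\<^sup>1\<close>
  is \<open>\<omega>\<^sup>\<lambda> n + \<rho>\<close> with \<open>\<rho> < \<omega>\<^sup>\<lambda>\<close>; cutting the function off near the points where \<open>n\<close> jumps or \<open>\<rho>\<close> is
  too large gives functions of smaller class that are locally eventually constant on the level sets
  of \<open>n\<close>.
\<close>

section \<open>Ordinal arithmetic\<close>

lemma ord_of_nat_simps [simp]:
  "ord_of_nat 0 = 0" "ord_of_nat (Suc n) = osucc (ord_of_nat n)"
  by (simp_all add: ord_of_nat_def)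

text \<open>An initial segment of an ordinal type modelled on the second uncountable cardinal has
  size at most the first one, so \<open>ord_bdd_above\<close> applies to its images. This makes the
  suprema in the limit clauses of the recursions genuine least upper bounds.\<close>

lemma bdd_above_image_lessThan [simp]:
  fixes b :: ordinal and f :: "ordinal \<Rightarrow> ordinal"
  shows "bdd_above (f ` {..<b})"
proof (rule ord_bdd_above)
  let ?r = "BNF_Cardinal_Order_Relation.cardSuc (BNF_Cardinal_Order_Relation.cardSuc natLeq)"
  have "Rep_ordinal ` {..<b} \<subseteq> underS ?r (Rep_ordinal b)"
    by (auto simp: underS_def less_ordinal_def less_eq_ordinal_def Rep_ordinal_inject)
  then have "ordLeq3 (card_of (Rep_ordinal ` {..<b})) (card_of (underS ?r (Rep_ordinal b)))"
    by (rule card_of_mono1)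
  moreover have "(card_of (underS ?r (Rep_ordinal b)), ?r) \<in> ordLess"
    by (rule card_of_underS[OF aleph2_Card_order Rep_ordinal])
  ultimately have "(card_of (Rep_ordinal ` {..<b}), ?r) \<in> ordLess"
    by (rule ordLeq_ordLess_trans)
  then have "ordLeq3 (card_of (Rep_ordinal ` {..<b})) (BNF_Cardinal_Order_Relation.cardSuc natLeq)"
    by (subst (asm) cardSuc_ordLeq_ordLess)
      (simp_all add: cardSuc_Card_order natLeq_Card_order card_of_Card_order)
  moreover have "f ` {..<b} = (f \<circ> Abs_ordinal) ` Rep_ordinal ` {..<b}"
    by (simp add: image_comp Rep_ordinal_inverse)
  ultimately show "ordLeq3 (card_of (f ` {..<b})) (BNF_Cardinal_Order_Relation.cardSuc natLeq)"
    using card_of_image ordLeq_transitive by metis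
qed

lemma is_limit_lessThan_ne [simp]: "is_limit b \<Longrightarrow> {..<b} \<noteq> {}"
  by (metis is_limit_def lessThan_iff empty_iff ord_zero_less_iff)

lemma is_limit_pos: "is_limit b \<Longrightarrow> 0 < b"
  by (simp add: is_limit_def ord_zero_less_iff)

lemma is_limit_osucc_less: "is_limit b \<Longrightarrow> a < b \<Longrightarrow> osucc a < b"
  by (simp add: is_limit_def)

lemma less_SUP_lessThan_iff:
  fixes f :: "ordinal \<Rightarrow> ordinal"
  shows "is_limit b \<Longrightarrow> x < (SUP c\<in>{..<b}. f c) \<longleftrightarrow> (\<exists>c<b. x < f c)"
  by (subst less_cSUP_iff) auto

lemma SUP_lessThan_le_iff:
  fixes f :: "ordinal \<Rightarrow> ordinal"
  shows "is_limit b \<Longrightarrow> (SUP c\<in>{..<b}. f c) \<le> x \<longleftrightarrow> (\<forall>c<b. f c \<le> x)"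
  by (meson less_SUP_lessThan_iff not_le)

lemma ord_induct [case_names zero osucc limit]:
  assumes "P 0" "\<And>a. P a \<Longrightarrow> P (osucc a)" "\<And>a. is_limit a \<Longrightarrow> (\<And>b. b < a \<Longrightarrow> P b) \<Longrightarrow> P a"
  shows "P (a :: ordinal)"
proof (induction a rule: less_induct)
  case (less a)
  then show ?case
    by (cases a rule: ord_cases) (auto intro: assms)
qed

lemma osucc_less_iff [simp]: "osucc a < osucc b \<longleftrightarrow> a < b"
  by (metis less_osucc_iff osucc_le_iff)

lemma osucc_le_osucc_iff [simp]: "osucc a \<le> osucc b \<longleftrightarrow> a \<le> b"
  by (simp add: not_less[symmetric])

subsection \<open>Addition\<close>

lemma ord_add_le_mono_limit: "is_limit b \<Longrightarrow> c < b \<Longrightarrow> a + c \<le> a + (b :: ordinal)"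
  by (simp add: cSUP_upper)

lemma ord_add_less_mono: "b < c \<Longrightarrow> a + b < a + (c :: ordinal)"
proof (induction c rule: ord_induct)
  case (osucc c)
  then show ?case
    by (metis less_osucc less_osucc_iff less_trans order_le_less plus_ordinal.simps(2))
next
  case (limit c)
  then have "osucc b < c" by (simp add: is_limit_def)
  with limit have "a + osucc b \<le> a + c" by (intro ord_add_le_mono_limit)
  then show ?case by (simp add: osucc_le_iff)
qed simp

lemma ord_add_less_iff [simp]: "a + b < a + c \<longleftrightarrow> b < (c :: ordinal)"
  by (metis ord_add_less_mono less_irrefl less_trans neqE)

lemma ord_add_le_iff [simp]: "a + b \<le> a + c \<longleftrightarrow> b \<le> (c :: ordinal)"
  by (simp add: not_less[symmetric])

lemma ord_add_cancel [simp]: "a + b = a + c \<longleftrightarrow> b = (c :: ordinal)"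
  by (metis ord_add_less_iff neqE less_irrefl)

lemma ord_le_add_left: "a \<le> a + (b :: ordinal)"
  by (metis ord_add_le_iff ord_zero_le plus_ordinal.simps(1))

lemma ord_le_add_right: "b \<le> a + (b :: ordinal)"
proof (induction b rule: ord_induct)
  case (limit b)
  show ?case
  proof (rule ccontr)
    assume "\<not> b \<le> a + b"
    then have "a + b < b" by simp
    \<comment> \<open>The induction hypothesis is applied to the ordinal \<open>a + b\<close>
      itself; strict monotonicity of addition gives the opposite inequality.\<close>
    with limit have "a + b \<le> a + (a + b)" by blast
    then show False using \<open>a + b < b\<close> by simp
  qed
qed simp_all

lemma ord_zero_add [simp]: "0 + b = (b :: ordinal)"
proof (induction b rule: ord_induct)
  case (limit b)
  have "0 + b = (SUP c\<in>{..<b}. 0 + c)" using limit(1) by simp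
  also have "\<dots> \<le> b"
    by (subst SUP_lessThan_le_iff) (use limit in auto)
  finally have "0 + b \<le> b" .
  then show ?case
    by (simp add: ord_le_add_right order_antisym)
qed simp_all

text \<open>The remainder is the least \<open>r\<close> with \<open>c \<le> a + r\<close>;
  minimality forces equality because right addition is continuous at limits and moves by one step at
  successors.\<close>

lemma ord_diff:
  assumes "a \<le> (c :: ordinal)"
  obtains r where "c = a + r"
proof -
  define r where "r = (LEAST r. c \<le> a + r)"
  have r: "c \<le> a + r"
    unfolding r_def by (rule LeastI[of _ c]) (rule ord_le_add_right)
  have min: "a + s < c" if "s < r" for s
    using not_less_Least[OF that[unfolded r_def]] by simp
  have "c = a + r"
  proof (cases r rule: ord_cases)
    case 1
    then show ?thesis using r assms by simp
  next
    case (2 s)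
    then have "osucc (a + s) \<le> c" using min[of s] by (simp add: osucc_le_iff)
    then show ?thesis using r 2 by simp
  next
    case 3
    then have "a + r \<le> c"
      using min by (simp add: SUP_lessThan_le_iff less_imp_le)
    then show ?thesis using r by simp
  qed
  then show thesis by (rule that)
qed

lemma is_limit_add:
  assumes "is_limit b"
  shows "is_limit (a + b)"
  unfolding is_limit_def
proof (intro conjI allI impI)
  have "0 < a + b"
    using is_limit_pos[OF assms] ord_le_add_right[of b a] by (rule less_le_trans)
  then show "a + b \<noteq> 0" by auto
  fix c assume "c < a + b"
  then obtain d where "d < b" "c < a + d"
    using assms by (auto simp: less_SUP_lessThan_iff)
  then have "osucc c \<le> a + d" by (simp add: osucc_le_iff)
  also have "a + d < a + b" using \<open>d < b\<close> by simp
  finally show "osucc c < a + b" .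
qed

subsection \<open>Parity\<close>

text \<open>Successors are stripped from both sides simultaneously; neither zero nor a limit is a
  successor, so both finite parts run out together.\<close>

lemma limit_add_nat_inject:
  assumes "b = 0 \<or> is_limit b" "b' = 0 \<or> is_limit b'" "b + ord_of_nat n = b' + ord_of_nat m"
  shows "n = m"
  using assms(3)
proof (induction n arbitrary: m)
  case 0
  then show ?case using assms(1) by (cases m) auto
next
  case (Suc n)
  then show ?case using assms(2) by (cases m) auto
qed

lemma limit_add_nat_cases:
  obtains b n where "b = 0 \<or> is_limit b" "a = b + ord_of_nat n"
proof -
  have "\<exists>b n. (b = 0 \<or> is_limit b) \<and> a = b + ord_of_nat n"
  proof (induction a rule: ord_induct)
    case zero
    then show ?case by (intro exI[of _ 0]) simp
  next
    case (osucc a)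
    then show ?case by (metis ord_of_nat_simps(2) plus_ordinal.simps(2))
  next
    case (limit a)
    then show ?case by (metis ord_of_nat_simps(1) plus_ordinal.simps(1))
  qed
  then show thesis using that by blast
qed

lemma ord_even_limit_add_nat:
  assumes "b = 0 \<or> is_limit b"
  shows "ord_even (b + ord_of_nat n) \<longleftrightarrow> even n"
  using assms limit_add_nat_inject unfolding ord_even_def by metis

lemma ord_even_zero [simp]: "ord_even 0"
  using ord_even_limit_add_nat[of 0 0] by simp

lemma ord_even_osucc [simp]: "ord_even (osucc a) \<longleftrightarrow> \<not> ord_even a"
proof -
  obtain b n where "b = 0 \<or> is_limit b" "a = b + ord_of_nat n"
    by (rule limit_add_nat_cases)
  then show ?thesis
    using ord_even_limit_add_nat[of b n] ord_even_limit_add_nat[of b "Suc n"] by simp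
qed

lemma ord_even_limit: "is_limit a \<Longrightarrow> ord_even a"
  using ord_even_limit_add_nat[of a 0] by simp

text \<open>Allows an alternation between two sets to be resumed at a limit stage with its phases
  unchanged.\<close>

lemma ord_even_add:
  assumes "b = 0 \<or> is_limit b"
  shows "ord_even (b + a) \<longleftrightarrow> ord_even a"
proof (induction a rule: ord_induct)
  case zero
  then show ?case using assms ord_even_limit by auto
next
  case (limit a)
  then show ?case using ord_even_limit is_limit_add by metis
qed simp

subsection \<open>Powers of \<open>\<omega>\<close>\<close>

lemma ord_of_nat_less_omega: "ord_of_nat n < omega"
  using is_limit_omega by (induction n) (simp_all add: is_limit_pos is_limit_osucc_less)

lemma less_omegaE:
  assumes "a < omega"
  obtains n where "a = ord_of_nat n"
proof -
  obtain b n where bn: "b = 0 \<or> is_limit b" "a = b + ord_of_nat n"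
    by (rule limit_add_nat_cases)
  have "b < omega" using assms bn(2) ord_le_add_left le_less_trans by blast
  then have "\<not> is_limit b" unfolding omega_def by (rule not_less_Least)
  then show thesis using bn that by simp
qed

lemma ord_of_nat_less_iff [simp]: "ord_of_nat m < ord_of_nat n \<longleftrightarrow> m < n"
proof -
  have "strict_mono ord_of_nat" by (simp add: strict_mono_Suc_iff)
  then show ?thesis by (simp add: strict_mono_less)
qed

lemma less_times_omega_iff: "x < a * omega \<longleftrightarrow> (\<exists>n. x < a * ord_of_nat n)"
  using ord_of_nat_less_omega less_omegaE
  by (simp add: is_limit_omega less_SUP_lessThan_iff) metis

lemma times_nat_less:
  assumes "0 < (a :: ordinal)" "m < n"
  shows "a * ord_of_nat m < a * ord_of_nat n"
proof -
  have "a * ord_of_nat k < a * ord_of_nat (Suc k)" for k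
    using assms(1) ord_add_less_mono[of 0 a] by simp
  then have "strict_mono (\<lambda>k. a * ord_of_nat k)"
    by (simp add: strict_mono_Suc_iff)
  from strict_monoD[OF this assms(2)] show ?thesis .
qed

lemma times_nat_le: "m \<le> n \<Longrightarrow> a * ord_of_nat m \<le> a * ord_of_nat n"
proof (induction n)
  case (Suc n)
  then show ?case
    by (cases "m = Suc n") (auto intro: order_trans[OF _ ord_le_add_left])
qed simp

lemma times_nat_add_less:
  assumes "r < a" "m < n"
  shows "a * ord_of_nat m + r < a * ord_of_nat n"
proof -
  have "a * ord_of_nat m + r < a * ord_of_nat (Suc m)" using assms by simp
  also have "\<dots> \<le> a * ord_of_nat n" using assms by (intro times_nat_le) simp
  finally show ?thesis .
qed

lemma times_nat_add_less_times_omega: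
  assumes "r < a"
  shows "a * ord_of_nat m + r < a * omega"
  using times_nat_add_less[OF assms, of m "Suc m"] less_times_omega_iff by blast

text \<open>Division with remainder: the quotient is the predecessor of the least \<open>n\<close>
  whose multiple of \<open>a\<close> exceeds \<open>x\<close>.\<close>

lemma times_omega_div:
  assumes "x < a * omega"
  obtains n r where "x = a * ord_of_nat n + r" "r < a"
proof -
  define n where "n = (LEAST n. x < a * ord_of_nat n)"
  have n: "x < a * ord_of_nat n"
    unfolding n_def using assms less_times_omega_iff by (metis LeastI)
  then obtain k where k: "n = Suc k" by (cases n) auto
  then have "a * ord_of_nat k \<le> x"
    using not_less_Least[of k "\<lambda>n. x < a * ord_of_nat n"] unfolding n_def[symmetric] by simp
  then obtain r where "x = a * ord_of_nat k + r" by (rule ord_diff)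
  moreover from this have "r < a" using n k by simp
  ultimately show thesis by (rule that)
qed

lemma is_limit_times_omega:
  assumes "0 < a"
  shows "is_limit (a * omega)"
  unfolding is_limit_def
proof (intro conjI allI impI)
  have *: "a * ord_of_nat n < a * omega" for n
    using times_nat_less[OF assms, of n "Suc n"] less_times_omega_iff by blast
  show "a * omega \<noteq> 0" using *[of 0] by auto
  fix x assume "x < a * omega"
  then obtain n where "x < a * ord_of_nat n" using less_times_omega_iff by blast
  then show "osucc x < a * omega"
    using *[of n] osucc_le_iff[of x] le_less_trans by blast
qed

lemma less_times_omega: "0 < a \<Longrightarrow> a < a * omega"
  using times_nat_add_less_times_omega[of 0 a 1] by simp

lemma opow_omega_pos: "0 < omega ^\<^sub>o a"
proof (induction a rule: ord_induct)
  case zero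
  then show ?case by (simp add: one_eq_osucc ord_zero_less_iff)
next
  case (osucc a)
  then show ?case using less_times_omega less_trans by simp blast
next
  case (limit a)
  then show ?case using is_limit_pos by (auto simp: less_SUP_lessThan_iff)
qed

lemma opow_omega_less: "a < b \<Longrightarrow> omega ^\<^sub>o a < omega ^\<^sub>o b"
proof (induction b rule: ord_induct)
  case (osucc b)
  then have "omega ^\<^sub>o a \<le> omega ^\<^sub>o b"
    by (metis less_imp_le less_osucc_iff order_le_less)
  also have "\<dots> < omega ^\<^sub>o osucc b" by (simp add: less_times_omega opow_omega_pos)
  finally show ?case .
next
  case (limit b)
  then have "osucc a < b" "a < osucc a" by (simp_all add: is_limit_def)
  then show ?case using limit by (auto simp: less_SUP_lessThan_iff simp del: opow.simps(1,2))
qed simp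

lemma opow_omega_le: "a \<le> b \<Longrightarrow> omega ^\<^sub>o a \<le> omega ^\<^sub>o b"
  by (metis opow_omega_less order_le_less)

lemma opow_omega_cofinal:
  assumes "0 < b" "x < omega ^\<^sub>o b"
  shows "\<exists>a<b. x < omega ^\<^sub>o osucc a"
proof (cases b rule: ord_cases)
  case 3
  then obtain a where "a < b" "x < omega ^\<^sub>o a" using assms by (auto simp: less_SUP_lessThan_iff)
  moreover have "omega ^\<^sub>o a < omega ^\<^sub>o osucc a" by (rule opow_omega_less) simp
  ultimately show ?thesis by (meson less_trans)
qed (use assms less_osucc in \<open>blast+ | simp\<close>)

lemma is_limit_opow_omega:
  assumes "0 < b"
  shows "is_limit (omega ^\<^sub>o b)"
  unfolding is_limit_def
proof (intro conjI allI impI)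
  show "omega ^\<^sub>o b \<noteq> 0" using opow_omega_pos ord_zero_less_iff by blast
  fix x assume "x < omega ^\<^sub>o b"
  then obtain a where a: "a < b" "x < omega ^\<^sub>o osucc a" using opow_omega_cofinal assms by blast
  have "is_limit (omega ^\<^sub>o osucc a)" by (simp add: is_limit_times_omega opow_omega_pos)
  then have "osucc x < omega ^\<^sub>o osucc a" using a(2) by (rule is_limit_osucc_less)
  also have "\<dots> \<le> omega ^\<^sub>o b" using a(1) by (intro opow_omega_le) (simp add: osucc_le_iff)
  finally show "osucc x < omega ^\<^sub>o b" .
qed

section \<open>Closure of the countable ordinals under the arithmetic operations\<close>

lemma SUP_less_omega1:
  assumes "is_limit b" "b < omega1" "\<And>c. c < b \<Longrightarrow> f c < omega1"
  shows "(SUP c\<in>{..<b}. f c) < omega1"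
proof -
  have "{..<(SUP c\<in>{..<b}. f c)} = (\<Union>c\<in>{..<b}. {..<f c})"
    using assms(1) by (auto simp: less_SUP_lessThan_iff)
  moreover have "countable \<dots>"
    using assms(2,3) by (intro countable_UN) (auto simp: less_omega1_iff)
  ultimately show ?thesis by (simp add: less_omega1_iff)
qed

lemma osucc_less_omega1: "a < omega1 \<Longrightarrow> osucc a < omega1"
  using is_limit_omega1 by (rule is_limit_osucc_less)

lemma add_less_omega1: "a < omega1 \<Longrightarrow> b < omega1 \<Longrightarrow> a + b < omega1"
proof (induction b rule: ord_induct)
  case (osucc b)
  then show ?case by (simp add: osucc_less_omega1) (meson less_osucc less_trans osucc_less_omega1)
next
  case (limit b)
  then show ?case by (simp add: SUP_less_omega1)
qed simp

lemma omega_less_omega1: "omega < omega1"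
proof -
  have "{..<omega} \<subseteq> range ord_of_nat" by (auto elim: less_omegaE)
  then show ?thesis unfolding less_omega1_iff by (rule countable_subset) simp
qed

lemma times_omega_less_omega1:
  assumes "a < omega1"
  shows "a * omega < omega1"
proof -
  have "a * ord_of_nat n < omega1" for n
    using assms is_limit_pos[OF is_limit_omega1] by (induction n) (simp_all add: add_less_omega1)
  then show ?thesis
    using is_limit_omega omega_less_omega1 by (auto intro!: SUP_less_omega1 elim: less_omegaE)
qed

lemma opow_omega_less_omega1: "b < omega1 \<Longrightarrow> omega ^\<^sub>o b < omega1"
proof (induction b rule: ord_induct)
  case zero
  then show ?case by (simp add: one_eq_osucc osucc_less_omega1)
next
  case (osucc b)
  then show ?case by (simp add: times_omega_less_omega1) (meson less_osucc less_trans times_omega_less_omega1)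
next
  case (limit b)
  then show ?case by (simp add: SUP_less_omega1)
qed

subsection \<open>The natural sum\<close>

text \<open>This is the Hessenberg natural sum. Unlike ordinary addition it is strictly increasing
  in both arguments, which is what adding two rank functions requires.\<close>

function hsum :: "ordinal \<Rightarrow> ordinal \<Rightarrow> ordinal" where
  "hsum a b = (LEAST c. (\<forall>a'\<in>{..<a}. hsum a' b < c) \<and> (\<forall>b'\<in>{..<b}. hsum a b' < c))"
  by auto
termination
  by (relation "{(a :: ordinal, b). a < b} <*lex*> {(a :: ordinal, b). a < b}")
    (auto simp: wf_less_ordinal)

declare hsum.simps [simp del]

lemma hsum_le:
  assumes "\<And>a'. a' < a \<Longrightarrow> hsum a' b < c" "\<And>b'. b' < b \<Longrightarrow> hsum a b' < c"
  shows "hsum a b \<le> c"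
  by (subst hsum.simps, rule Least_le) (use assms in auto)

lemma hsum_less:
  shows "a' < a \<Longrightarrow> hsum a' b < hsum a b" and "b' < b \<Longrightarrow> hsum a b' < hsum a b"
proof -
  obtain c where c: "\<forall>a'<a. hsum a' b \<le> c"
    using bdd_above_image_lessThan[of "\<lambda>a'. hsum a' b" a] by (auto simp: bdd_above_def)
  obtain d where d: "\<forall>b'<b. hsum a b' \<le> d"
    using bdd_above_image_lessThan[of "hsum a" b] by (auto simp: bdd_above_def)
  have "\<exists>c. (\<forall>a'\<in>{..<a}. hsum a' b < c) \<and> (\<forall>b'\<in>{..<b}. hsum a b' < c)"
    using c d by (intro exI[of _ "osucc (max c d)"]) (auto simp: less_osucc_iff le_max_iff_disj)
  then have "(\<forall>a'\<in>{..<a}. hsum a' b < hsum a b) \<and> (\<forall>b'\<in>{..<b}. hsum a b' < hsum a b)"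
    by (subst (2 4) hsum.simps) (rule LeastI_ex)
  then show "a' < a \<Longrightarrow> hsum a' b < hsum a b" "b' < b \<Longrightarrow> hsum a b' < hsum a b"
    by auto
qed

lemma hsum_mono: "a' \<le> a \<Longrightarrow> b' \<le> b \<Longrightarrow> hsum a' b' \<le> hsum a b"
  by (metis hsum_less order_le_less order_trans)

lemma hsum_eq_iff: "a' \<le> a \<Longrightarrow> b' \<le> b \<Longrightarrow> hsum a' b' = hsum a b \<longleftrightarrow> a' = a \<and> b' = b"
  by (metis hsum_less hsum_mono order_le_less less_le_not_le)

text \<open>Induction on both summands: lowering one of them lowers its quotient by
  \<open>k\<close>, or keeps the quotient and lowers the remainder. In either case the proposed
  bound drops strictly.\<close>

lemma hsum_div_le:
  assumes k: "0 < k" and closed: "\<And>a b. a < k \<Longrightarrow> b < k \<Longrightarrow> hsum a b < k"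
    and "a < k" "b < k"
  shows "hsum (k * ord_of_nat m + a) (k * ord_of_nat n + b) \<le> k * ord_of_nat (m + n) + hsum a b"
proof -
  have main: "\<lbrakk>x = k * ord_of_nat m + a; y = k * ord_of_nat n + b; a < k; b < k\<rbrakk>
      \<Longrightarrow> hsum x y \<le> k * ord_of_nat (m + n) + hsum a b" for x y m a n b
  proof (induction x y arbitrary: m a n b rule: hsum.induct)
    case (1 x y)
    have split: "\<exists>m' a'. x' = k * ord_of_nat m' + a' \<and> a' < k \<and> (m' < m \<or> m' = m \<and> a' < a)"
      if "x' < k * ord_of_nat m + a" "a < k" for x' m a
    proof -
      have "x' < k * omega" using that times_nat_add_less_times_omega less_trans by blast
      then obtain m' a' where x': "x' = k * ord_of_nat m' + a'" "a' < k" by (rule times_omega_div)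
      have "\<not> m < m'"
        using times_nat_add_less[OF that(2), of m m'] ord_le_add_left[of "k * ord_of_nat m'" a'] that(1) x'
        by auto
      then show ?thesis using x' that by (metis ord_add_less_iff linorder_neqE_nat)
    qed
    \<comment> \<open>A smaller sum of quotients outweighs every change of remainders, since
      remainders have natural sum below \<open>k\<close>.\<close>
    have bound: "k * ord_of_nat (m' + n') + hsum a' b' < k * ord_of_nat (m + n) + hsum a b"
      if "a' < k" "b' < k" "m' + n' < m + n" for a' b' m' n'
      using times_nat_add_less[OF closed[OF that(1,2)] that(3)] ord_le_add_left less_le_trans by blast
    show ?case
    proof (rule hsum_le)
      fix x' assume x': "x' < x"
      then obtain m' a' where m': "x' = k * ord_of_nat m' + a'" "a' < k" "m' < m \<or> m' = m \<and> a' < a"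
        using split 1(3,5) by blast
      then have "hsum x' y \<le> k * ord_of_nat (m' + n) + hsum a' b"
        using 1 x' by auto
      also have "\<dots> < k * ord_of_nat (m + n) + hsum a b"
        using m'(3) bound[OF m'(2) 1(6)] hsum_less(1) by auto
      finally show "hsum x' y < k * ord_of_nat (m + n) + hsum a b" .
    next
      fix y' assume y': "y' < y"
      then obtain n' b' where n': "y' = k * ord_of_nat n' + b'" "b' < k" "n' < n \<or> n' = n \<and> b' < b"
        using split 1(4,6) by blast
      then have "hsum x y' \<le> k * ord_of_nat (m + n') + hsum a b'"
        using 1 y' by auto
      also have "\<dots> < k * ord_of_nat (m + n) + hsum a b"
        using n'(3) bound[OF 1(5) n'(2)] hsum_less(2) by auto
      finally show "hsum x y' < k * ord_of_nat (m + n) + hsum a b" .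
    qed
  qed
  show ?thesis by (rule main) (use assms in auto)
qed

text \<open>At successors both summands are divided by the previous power, which is closed under the
  sum by induction; at limits both already lie below a common smaller power.\<close>

lemma hsum_less_opow_omega: "a < omega ^\<^sub>o l \<Longrightarrow> b < omega ^\<^sub>o l \<Longrightarrow> hsum a b < omega ^\<^sub>o l"
proof (induction l arbitrary: a b rule: ord_induct)
  case zero
  then have "hsum a b \<le> 0"
    by (intro hsum_le) (auto simp: one_eq_osucc less_osucc_iff dest: less_le_trans)
  then show ?case by (simp add: one_eq_osucc less_osucc_iff)
next
  case (osucc l)
  let ?k = "omega ^\<^sub>o l"
  from osucc.prems obtain m a' n b' where
    d: "a = ?k * ord_of_nat m + a'" "a' < ?k" "b = ?k * ord_of_nat n + b'" "b' < ?k"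
    using times_omega_div by (metis opow.simps(2))
  have "hsum a b \<le> ?k * ord_of_nat (m + n) + hsum a' b'"
    unfolding d(1,3) by (rule hsum_div_le[OF opow_omega_pos osucc.IH d(2,4)])
  also have "\<dots> < ?k * omega"
    by (intro times_nat_add_less_times_omega osucc.IH d)
  finally show ?case by simp
next
  case (limit l)
  then obtain c d where cd: "c < l" "a < omega ^\<^sub>o c" "d < l" "b < omega ^\<^sub>o d"
    by (auto simp: less_SUP_lessThan_iff)
  then have "max c d < l" "a < omega ^\<^sub>o max c d" "b < omega ^\<^sub>o max c d"
    by (metis max_def, metis less_le_trans max.cobounded1 opow_omega_le,
        metis less_le_trans max.cobounded2 opow_omega_le)
  then show ?case
    using limit.IH less_trans opow_omega_less by blast
qed

section \<open>Functions resolved by a rank function\<close>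

text \<open>
  Upper semicontinuous ordinal-valued functions \<open>r\<close> correspond to continuous decreasing transfinite
  sequences of closed sets \<open>{x. \<eta> \<le> r x}\<close>; the condition says that \<open>h\<close> is locally constant on each
  successive difference of that sequence.
\<close>

definition resolves :: "('a::topological_space \<Rightarrow> ordinal) \<Rightarrow> ('a \<Rightarrow> 'b) \<Rightarrow> bool" where
  "resolves r h \<longleftrightarrow>
     (\<forall>x. \<exists>U. open U \<and> x \<in> U \<and> (\<forall>y\<in>U. r y \<le> r x \<and> (r y = r x \<longrightarrow> h y = h x)))"

definition resolved :: "ordinal \<Rightarrow> ('a::topological_space \<Rightarrow> 'b) \<Rightarrow> bool" where
  "resolved k h \<longleftrightarrow> (\<exists>r. (\<forall>x. r x < k) \<and> resolves r h)"

lemma resolvesI: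
  assumes "\<And>x. \<exists>U. open U \<and> x \<in> U \<and> (\<forall>y\<in>U. r y \<le> r x \<and> (r y = r x \<longrightarrow> h y = h x))"
  shows "resolves r h"
  unfolding resolves_def using assms by (rule allI)

lemma resolvesE:
  assumes "resolves r h"
  obtains U where "open U" "x \<in> U" "\<forall>y\<in>U. r y \<le> r x"
    "\<forall>y\<in>U. r y = r x \<longrightarrow> h y = h x"
proof -
  from assms obtain U where "open U \<and> x \<in> U \<and> (\<forall>y\<in>U. r y \<le> r x \<and> (r y = r x \<longrightarrow> h y = h x))"
    unfolding resolves_def by (elim allE[of _ x] exE)
  then show thesis by (intro that[of U]) blast+
qed

lemma resolvedI: "(\<And>x. r x < k) \<Longrightarrow> resolves r h \<Longrightarrow> resolved k h"
  unfolding resolved_def by blast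

lemma resolvedE:
  assumes "resolved k h"
  obtains r where "\<forall>x. r x < k" "resolves r h"
  using assms unfolding resolved_def by blast

lemma resolved_comp:
  assumes "resolved k h"
  shows "resolved k (\<lambda>x. \<phi> (h x))"
proof -
  obtain r where r: "\<forall>x. r x < k" "resolves r h"
    using assms by (rule resolvedE)
  have "resolves r (\<lambda>x. \<phi> (h x))"
  proof (rule resolvesI)
    fix x
    obtain U where "open U" "x \<in> U" "\<forall>y\<in>U. r y \<le> r x"
      "\<forall>y\<in>U. r y = r x \<longrightarrow> h y = h x"
      using r(2) by (rule resolvesE[where x = x])
    then show "\<exists>U. open U \<and> x \<in> U \<and> (\<forall>y\<in>U. r y \<le> r x \<and> (r y = r x \<longrightarrow> \<phi> (h y) = \<phi> (h x)))"
      by (intro exI[of _ U]) metis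
  qed
  with r(1) show ?thesis by (auto intro: resolvedI)
qed

lemma resolved_const: "0 < k \<Longrightarrow> resolved k (\<lambda>x. c)"
  by (rule resolvedI[of "\<lambda>x. 0"]) (auto simp: resolves_def)

text \<open>The natural sum of the two ranks resolves the pair: near \<open>x\<close> neither rank
  exceeds its value at \<open>x\<close>, so equality of the sums forces equality of both
  ranks.\<close>

lemma resolved_Pair:
  assumes "resolved (omega ^\<^sub>o l) g" "resolved (omega ^\<^sub>o l) h"
  shows "resolved (omega ^\<^sub>o l) (\<lambda>x. (g x, h x))"
proof -
  obtain r where r: "\<forall>x. r x < omega ^\<^sub>o l" "resolves r g"
    using assms(1) by (rule resolvedE)
  obtain s where s: "\<forall>x. s x < omega ^\<^sub>o l" "resolves s h"
    using assms(2) by (rule resolvedE)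
  have "resolves (\<lambda>x. hsum (r x) (s x)) (\<lambda>x. (g x, h x))"
  proof (rule resolvesI)
    fix x
    obtain U where U: "open U" "x \<in> U" "\<forall>y\<in>U. r y \<le> r x"
      "\<forall>y\<in>U. r y = r x \<longrightarrow> g y = g x"
      using r(2) by (rule resolvesE[where x = x])
    obtain V where V: "open V" "x \<in> V" "\<forall>y\<in>V. s y \<le> s x"
      "\<forall>y\<in>V. s y = s x \<longrightarrow> h y = h x"
      using s(2) by (rule resolvesE[where x = x])
    show "\<exists>U. open U \<and> x \<in> U \<and> (\<forall>y\<in>U. hsum (r y) (s y) \<le> hsum (r x) (s x) \<and>
        (hsum (r y) (s y) = hsum (r x) (s x) \<longrightarrow> (g y, h y) = (g x, h x)))"
    proof (intro exI[of _ "U \<inter> V"] conjI ballI impI)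
      fix y assume y: "y \<in> U \<inter> V"
      then have le: "r y \<le> r x" "s y \<le> s x" using U(3) V(3) by blast+
      then show "hsum (r y) (s y) \<le> hsum (r x) (s x)" by (rule hsum_mono)
      assume "hsum (r y) (s y) = hsum (r x) (s x)"
      then have "r y = r x" "s y = s x" using hsum_eq_iff[OF le] by simp_all
      then show "(g y, h y) = (g x, h x)" using y U(4) V(4) by blast
    qed (use U V in auto)
  qed
  with r(1) s(1) show ?thesis
    by (intro resolvedI[of "\<lambda>x. hsum (r x) (s x)"]) (simp_all add: hsum_less_opow_omega)
qed

lemma resolved_comp2:
  assumes "resolved (omega ^\<^sub>o l) g" "resolved (omega ^\<^sub>o l) h"
  shows "resolved (omega ^\<^sub>o l) (\<lambda>x. \<phi> (g x) (h x))"
  using resolved_comp[OF resolved_Pair[OF assms], of "\<lambda>(u, v). \<phi> u v"] by simp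

lemma resolved_sum:
  fixes g :: "nat \<Rightarrow> 'a::topological_space \<Rightarrow> real"
  assumes "\<And>i. i < n \<Longrightarrow> resolved (omega ^\<^sub>o l) (g i)"
  shows "resolved (omega ^\<^sub>o l) (\<lambda>x. \<Sum>i<n. g i x)"
  using assms
proof (induction n)
  case 0
  then show ?case by (simp add: resolved_const opow_omega_pos)
next
  case (Suc n)
  have "resolved (omega ^\<^sub>o l) (\<lambda>x. \<Sum>i<n. g i x)" "resolved (omega ^\<^sub>o l) (g n)"
    using Suc by simp_all
  from resolved_comp2[OF this, of "(+)"] show ?case by simp
qed

section \<open>The separation rank\<close>

text \<open>A value below \<open>omega1\<close> is not the default of \<open>sep_rank\<close>, so a
  sequence of least length exists.\<close>

lemma sep_rank_leE:
  assumes "sep_rank A B \<le> k" "k < omega1"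
  obtains \<mu> F where "\<mu> \<le> k" "diff_seq \<mu> F" "separates \<mu> F A B"
proof -
  have ex: "\<exists>\<mu> F. diff_seq \<mu> F \<and> separates \<mu> F A B"
    using assms unfolding sep_rank_def by (auto split: if_splits)
  have "\<exists>F. diff_seq (sep_rank A B) F \<and> separates (sep_rank A B) F A B"
    unfolding sep_rank_def if_P[OF ex] by (rule LeastI_ex[OF ex])
  then show thesis using assms(1) that by blast
qed

lemma diff_seq_antimono: "diff_seq \<mu> F \<Longrightarrow> \<eta> \<le> \<zeta> \<Longrightarrow> F \<zeta> \<subseteq> F \<eta>"
  unfolding diff_seq_def by (metis empty_subsetI not_le)

lemma diff_seq_closed: "diff_seq \<mu> F \<Longrightarrow> closed (F \<eta>)"
  unfolding diff_seq_def by (metis closed_empty not_le)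

text \<open>The first index whose set misses \<open>x\<close> is a successor: continuity excludes
  limits inside the sequence, and the empty intersection excludes a limit at its end.\<close>

lemma diff_seq_last:
  assumes F: "diff_seq \<mu> F"
  shows "\<exists>\<eta><\<mu>. x \<in> F \<eta> - F (osucc \<eta>)"
proof -
  define \<theta> where "\<theta> = (LEAST \<theta>. x \<notin> F \<theta>)"
  have "x \<notin> F \<mu>" using F by (simp add: diff_seq_def)
  then have \<theta>: "x \<notin> F \<theta>" "\<theta> \<le> \<mu>"
    unfolding \<theta>_def by (rule LeastI, rule Least_le)
  have below: "x \<in> F \<eta>" if "\<eta> < \<theta>" for \<eta>
    using not_less_Least[OF that[unfolded \<theta>_def]] by simp
  have "\<not> is_limit \<theta>"
  proof
    assume lim: "is_limit \<theta>"
    have "x \<in> (\<Inter>\<eta>\<in>{..<\<theta>}. F \<eta>)" using below by blast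
    then show False
      using F lim \<theta> unfolding diff_seq_def by (metis empty_iff order_le_less)
  qed
  moreover have "\<theta> \<noteq> 0" using F \<theta> by (auto simp: diff_seq_def)
  ultimately obtain \<eta> where "\<theta> = osucc \<eta>" by (metis ord_cases)
  then show ?thesis
    using \<theta> below[of \<eta>] by (intro exI[of _ \<eta>]) (auto simp: osucc_le_iff)
qed

text \<open>Successive differences are disjoint, so a point in an odd difference lies in no even
  one.\<close>

lemma diff_seq_parity:
  assumes F: "diff_seq \<mu> F" "separates \<mu> F A B" and x: "x \<in> F \<eta> - F (osucc \<eta>)"
  shows "if ord_even \<eta> then x \<notin> B else x \<notin> A"
proof -
  have "\<eta> < \<mu>" using F x by (auto simp: diff_seq_def not_less[symmetric])
  have uniq: "\<zeta> = \<eta>" if "x \<in> F \<zeta> - F (osucc \<zeta>)" for \<zeta>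
    using that x diff_seq_antimono[OF F(1)] by (metis DiffD1 DiffD2 linorder_neqE osucc_le_iff subsetD)
  show ?thesis
  proof (cases "ord_even \<eta>")
    case True
    then have "x \<in> (\<Union>\<eta>\<in>{\<eta>. \<eta> < \<mu> \<and> ord_even \<eta>}. F \<eta> - F (osucc \<eta>))"
      using x \<open>\<eta> < \<mu>\<close> by blast
    then have "x \<in> - B" using F(2) unfolding separates_def by blast
    then show ?thesis using True by simp
  next
    case False
    then have "x \<notin> (\<Union>\<eta>\<in>{\<eta>. \<eta> < \<mu> \<and> ord_even \<eta>}. F \<eta> - F (osucc \<eta>))"
      using uniq by blast
    then have "x \<notin> A" using F(2) unfolding separates_def by blast
    then show ?thesis using False by simp
  qed
qed

text \<open>The index of the last set containing a point is a rank function. Its even values define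
  the separating set, so membership depends on the rank alone.\<close>

lemma sep_rank_le_imp_resolved:
  assumes "sep_rank A B \<le> k" "k < omega1"
  obtains S where "resolved k (\<lambda>x. x \<in> S)" "A \<subseteq> S" "S \<inter> B = {}"
proof -
  obtain \<mu> F where \<mu>: "\<mu> \<le> k" and F: "diff_seq \<mu> F" "separates \<mu> F A B"
    using assms by (rule sep_rank_leE)
  obtain r where r: "\<And>x. r x < \<mu> \<and> x \<in> F (r x) - F (osucc (r x))"
    using diff_seq_last[OF F(1)] by metis
  have "resolves r (\<lambda>x. x \<in> {x. ord_even (r x)})"
  proof (rule resolvesI)
    fix x
    have "r y \<le> r x" if "y \<notin> F (osucc (r x))" for y
      using that r[of y] diff_seq_antimono[OF F(1), of "osucc (r x)" "r y"]
      by (meson DiffD1 not_le osucc_le_iff subsetD)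
    moreover have "open (- F (osucc (r x)))" using diff_seq_closed[OF F(1)] by (simp add: open_Compl)
    ultimately show "\<exists>U. open U \<and> x \<in> U \<and>
        (\<forall>y\<in>U. r y \<le> r x \<and> (r y = r x \<longrightarrow> (y \<in> {x. ord_even (r x)}) = (x \<in> {x. ord_even (r x)})))"
      using r[of x] by (intro exI[of _ "- F (osucc (r x))"]) auto
  qed
  then have "resolved k (\<lambda>x. x \<in> {x. ord_even (r x)})"
    using r \<mu> by (intro resolvedI[of r]) (meson less_le_trans)
  moreover have "A \<subseteq> {x. ord_even (r x)}" "{x. ord_even (r x)} \<inter> B = {}"
    using diff_seq_parity[OF F] r by (fastforce split: if_splits)+
  ultimately show thesis by (rule that)
qed

text \<open>
  The fastest decreasing sequence whose differences alternately avoid \<open>B\<close> and \<open>A\<close>.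
\<close>

function altseq :: "'a::topological_space set \<Rightarrow> 'a set \<Rightarrow> ordinal \<Rightarrow> 'a set" where
  "altseq A B 0 = UNIV"
| "altseq A B (osucc a) = closure (altseq A B a \<inter> (if ord_even a then B else A))"
| "is_limit a \<Longrightarrow> altseq A B a = (\<Inter>b\<in>{..<a}. altseq A B b)"
  apply auto
  apply (metis ord_cases)+
  done
termination
  by (relation "inv_image {(a :: ordinal, b). a < b} (\<lambda>(A, B, a). a)")
    (auto intro!: wf_inv_image wf_less_ordinal)

lemma altseq_closed [simp]: "closed (altseq A B a)"
proof (induction a rule: ord_induct)
  case (limit a)
  then show ?case by (subst altseq.simps(3)) (blast intro: closed_INT)+
next
  case (osucc a)
  then show ?case by (subst altseq.simps(2)) (rule closed_closure)
qed simp

lemma altseq_osucc_subset: "altseq A B (osucc a) \<subseteq> altseq A B a"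
  unfolding altseq.simps(2) by (intro closure_minimal altseq_closed) auto

lemma altseq_antimono: "a \<le> b \<Longrightarrow> altseq A B b \<subseteq> altseq A B a"
proof (induction b rule: ord_induct)
  case (osucc b)
  show ?case
  proof (cases "a = osucc b")
    case False
    then have "a \<le> b" using osucc.prems by (metis less_osucc_iff order_le_less)
    then show ?thesis using altseq_osucc_subset osucc.IH by blast
  qed simp
next
  case (limit b)
  then show ?case by (cases "a = b") (auto simp: order_le_less)
next
  case zero
  then have "a = 0" by (simp add: order_antisym)
  then show ?case by simp
qed

text \<open>Cut off at \<open>k\<close>, the alternating sequence itself separates: an even step
  retains all remaining points of \<open>B\<close> and an odd step all remaining points of
  \<open>A\<close>, so such points can only leave at steps of the other parity.\<close>

lemma sep_rank_le_if_altseq_empty: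
  fixes A B :: "'a::topological_space set"
  assumes k: "is_limit k" "k < omega1" and empty: "altseq A B k = {}"
  shows "sep_rank A B \<le> k"
proof -
  define F where "F \<eta> = (if \<eta> < k then altseq A B \<eta> else {})" for \<eta>
  have F: "diff_seq k F"
    unfolding diff_seq_def
  proof (intro conjI allI impI)
    show "k < omega1" by (fact k)
    show "F 0 = UNIV" using is_limit_pos[OF k(1)] by (simp add: F_def)
    show "(\<Inter>\<eta>\<in>{..<k}. F \<eta>) = {}" using empty k(1) by (simp add: F_def)
  next
    fix \<theta> assume "\<theta> < k" "is_limit \<theta>"
    then show "F \<theta> = (\<Inter>\<eta>\<in>{..<\<theta>}. F \<eta>)" using less_trans by (auto simp: F_def)
  next
    fix \<zeta> \<eta> assume "\<zeta> < k" "\<eta> \<le> \<zeta>"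
    then show "F \<zeta> \<subseteq> F \<eta>" using altseq_antimono[of \<eta> \<zeta> A B] by (auto simp: F_def)
  qed (auto simp: F_def altseq_closed)
  have step: "F (osucc \<eta>) = closure (F \<eta> \<inter> (if ord_even \<eta> then B else A))" if "\<eta> < k" for \<eta>
    using that is_limit_osucc_less[OF k(1)] by (simp add: F_def)
  have "separates k F A B"
    unfolding separates_def
  proof
    show "A \<subseteq> (\<Union>\<eta>\<in>{\<eta>. \<eta> < k \<and> ord_even \<eta>}. F \<eta> - F (osucc \<eta>))"
    proof
      fix x assume "x \<in> A"
      obtain \<eta> where \<eta>: "\<eta> < k" "x \<in> F \<eta> - F (osucc \<eta>)" using diff_seq_last[OF F] by blast
      then have "ord_even \<eta>"
        using \<open>x \<in> A\<close> step[OF \<eta>(1)] closure_subset[of "F \<eta> \<inter> A"] by (auto split: if_splits)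
      with \<eta> show "x \<in> (\<Union>\<eta>\<in>{\<eta>. \<eta> < k \<and> ord_even \<eta>}. F \<eta> - F (osucc \<eta>))" by blast
    qed
    show "(\<Union>\<eta>\<in>{\<eta>. \<eta> < k \<and> ord_even \<eta>}. F \<eta> - F (osucc \<eta>)) \<subseteq> - B"
    proof clarify
      fix x \<eta> assume "\<eta> < k" "ord_even \<eta>" "x \<in> F \<eta>" "x \<notin> F (osucc \<eta>)" "x \<in> B"
      then show False using step[of \<eta>] closure_subset[of "F \<eta> \<inter> B"] by auto
    qed
  qed
  with F have ex: "\<exists>F::ordinal \<Rightarrow> 'a set. diff_seq k F \<and> separates k F A B" by blast
  then have "sep_rank A B = (LEAST \<mu>. \<exists>F. diff_seq \<mu> F \<and> separates \<mu> F A B)"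
    unfolding sep_rank_def by auto
  also have "\<dots> \<le> k" using ex by (rule Least_le)
  finally show ?thesis .
qed

text \<open>Consecutive stages have opposite parity, so one of the last two closures is taken with
  \<open>A\<close> and the other with \<open>B\<close>.\<close>

lemma altseq_three_steps:
  "altseq A B (osucc (osucc (osucc a))) \<subseteq> closure (altseq A B a \<inter> A) \<inter> closure (altseq A B a \<inter> B)"
proof -
  have *: "altseq A B (osucc b) \<subseteq> closure (altseq A B a \<inter> (if ord_even b then B else A))"
    if "a \<le> b" for b
    unfolding altseq.simps(2) using altseq_antimono[OF that, of A B] by (intro closure_mono) auto
  have le: "a \<le> osucc a" "a \<le> osucc (osucc a)"
    by (meson less_imp_le less_osucc less_trans)+
  have sub: "altseq A B (osucc (osucc (osucc a))) \<subseteq> altseq A B (osucc (osucc a))"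
    by (rule altseq_osucc_subset)
  from *[OF le(1)] *[OF le(2)] sub show ?thesis
    by (cases "ord_even a") (auto simp del: altseq.simps)
qed

text \<open>Points leave in order of rank. Once all lower ranks near \<open>x\<close> are gone,
  \<open>h\<close> is constant on what remains there; surviving three more stages would make
  \<open>x\<close> a limit of remaining points of both \<open>A\<close> and \<open>B\<close>, whose
  values of \<open>h\<close> differ.\<close>

lemma altseq_empty_if_resolved:
  assumes h: "resolved (omega ^\<^sub>o l) h" and l: "0 < l"
    and sep: "\<And>x y. x \<in> A \<Longrightarrow> y \<in> B \<Longrightarrow> h x \<noteq> h y"
  shows "altseq A B (omega ^\<^sub>o l) = {}"
proof -
  obtain r where r: "\<forall>x. r x < omega ^\<^sub>o l" and nbhd: "resolves r h"
    using h by (rule resolvedE)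
  \<comment> \<open>Doubling twice by natural sums leaves at least three free stages between
    consecutive ranks, while \<open>\<omega>\<^sup>l\<close> stays closed under the
    operation.\<close>
  define Q where "Q a = hsum (hsum a a) (hsum a a)" for a
  define T where "T a = osucc (osucc (osucc (Q a)))" for a
  have T_less: "T a \<le> Q b" if "a < b" for a b
  proof -
    have two: "osucc (hsum c c) < hsum d d" if "c < d" for c d
      using hsum_less(1)[OF that, of c] hsum_less(2)[OF that, of d] by (meson le_less_trans osucc_le_iff)
    let ?e = "osucc (hsum a a)"
    have "T a \<le> osucc (hsum ?e ?e)"
      using two[of "hsum a a" ?e] by (simp add: T_def Q_def osucc_le_iff)
    also have "\<dots> < Q b"
      unfolding Q_def by (rule two) (rule two[OF that])
    finally show ?thesis by simp
  qed
  have main: "x \<notin> altseq A B (T (r x))" for x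
  proof (induction "r x" arbitrary: x rule: less_induct)
    case less
    obtain U where U: "open U" "x \<in> U" "\<forall>y\<in>U. r y \<le> r x"
      "\<forall>y\<in>U. r y = r x \<longrightarrow> h y = h x"
      using nbhd by (rule resolvesE[where x = x])
    have const: "h y = h x" if "y \<in> U" "y \<in> altseq A B (Q (r x))" for y
    proof (rule ccontr)
      assume "h y \<noteq> h x"
      then have "r y < r x" using U(3,4) that by (meson order_le_less)
      then have "y \<notin> altseq A B (T (r y))" "T (r y) \<le> Q (r x)"
        using less.hyps T_less by blast+
      then show False using that altseq_antimono by blast
    qed
    show ?case
    proof
      assume "x \<in> altseq A B (T (r x))"
      then have "x \<in> closure (altseq A B (Q (r x)) \<inter> A)" "x \<in> closure (altseq A B (Q (r x)) \<inter> B)"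
        using altseq_three_steps[of A B "Q (r x)"] unfolding T_def by blast+
      then have "U \<inter> (altseq A B (Q (r x)) \<inter> A) \<noteq> {}" "U \<inter> (altseq A B (Q (r x)) \<inter> B) \<noteq> {}"
        using U(2) open_Int_closure_eq_empty[OF U(1)] by blast+
      then obtain y z where "y \<in> U" "y \<in> altseq A B (Q (r x))" "y \<in> A"
        "z \<in> U" "z \<in> altseq A B (Q (r x))" "z \<in> B"
        by blast
      then show False using const[of y] const[of z] sep[of y z] by simp
    qed
  qed
  have "T (r x) < omega ^\<^sub>o l" for x
    unfolding T_def Q_def using r
    by (intro is_limit_osucc_less[OF is_limit_opow_omega[OF l]] hsum_less_opow_omega) auto
  then have "x \<notin> altseq A B (omega ^\<^sub>o l)" for x
    using main[of x] altseq_antimono[of "T (r x)" "omega ^\<^sub>o l"] by (meson less_imp_le subsetD)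
  then show ?thesis by blast
qed

section \<open>Uniform approximation by resolved functions\<close>

lemma resolves_closed:
  assumes "resolves r h"
  shows "closed {y. a \<le> r y}"
proof -
  have "open {y. r y < a}"
  proof (subst open_subopen, intro ballI)
    fix x assume "x \<in> {y. r y < a}"
    moreover obtain U where "open U" "x \<in> U" "\<forall>y\<in>U. r y \<le> r x"
      using assms by (rule resolvesE[where x = x])
    ultimately show "\<exists>T. open T \<and> x \<in> T \<and> T \<subseteq> {y. r y < a}"
      by (intro exI[of _ U]) (auto intro: le_less_trans)
  qed
  moreover have "{y. r y < a} = - {y. a \<le> r y}" by auto
  ultimately show ?thesis by (simp add: closed_def)
qed

text \<open>The pointwise form of "at distance at least \<open>e\<close> from a set" is vacuous for
  the empty set, so no separate case arises.\<close>

lemma closed_dist_ge: "closed {y :: 'a::metric_space. \<forall>z. P z \<longrightarrow> e \<le> dist y z}"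
  by (intro closed_Collect_all closed_Collect_imp closed_Collect_le open_Collect_const continuous_intros)

text \<open>By Tietze, \<open>h\<close> extends continuously from each finite union of the cover; at
  a given point these extensions eventually equal \<open>h\<close>.\<close>

lemma baire1_closed_cover:
  fixes h :: "'a::{metric_space, second_countable_topology} \<Rightarrow> real" and K :: "nat \<Rightarrow> 'a set"
  assumes closed: "\<And>i. closed (K i)" and cover: "(\<Union>i. K i) = UNIV"
    and cont: "\<And>i. continuous_on (K i) h" and bdd: "bounded (range h)"
  shows "baire1 h"
proof -
  obtain B where B: "\<And>x. norm (h x) \<le> B"
    using bdd unfolding bounded_iff by blast
  then have "0 \<le> B" using norm_ge_zero order_trans by blast
  have "\<exists>g. continuous_on UNIV g \<and> (\<forall>x\<in>(\<Union>i\<le>n. K i). g x = h x)" for n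
  proof -
    have "continuous_on (\<Union>i\<le>n. K i) h"
      by (intro continuous_on_closed_Union closed cont) simp
    moreover have "closedin (top_of_set UNIV) (\<Union>i\<le>n. K i)"
      using closed by (simp add: closed_UN)
    ultimately show ?thesis
      using Tietze[of "\<Union>i\<le>n. K i" h UNIV B] B \<open>0 \<le> B\<close> by metis
  qed
  then obtain g where g: "\<And>n. continuous_on UNIV (g n)" "\<And>n x. x \<in> (\<Union>i\<le>n. K i) \<Longrightarrow> g n x = h x"
    by metis
  have "(\<lambda>n. g n x) \<longlonglongrightarrow> h x" for x
  proof -
    obtain i where "x \<in> K i" using cover by blast
    then have "\<forall>n\<ge>i. g n x = h x" using g(2) by blast
    then show ?thesis
      by (intro tendsto_eventually) (auto simp: eventually_sequentially)
  qed
  with g(1) show ?thesis unfolding baire1_def by blast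
qed

text \<open>Countably many ranks and basic open sets yield a countable closed cover on whose members
  \<open>h\<close> is constant.\<close>

lemma resolved_imp_baire1:
  fixes h :: "'a::{metric_space, second_countable_topology} \<Rightarrow> real"
  assumes "resolved k h" "k < omega1" and bdd: "bounded (range h)"
  shows "baire1 h"
proof -
  obtain r where rk: "\<forall>x. r x < k" and r: "resolves r h"
    using assms(1) by (rule resolvedE)
  obtain \<B> :: "'a set set" where \<B>: "countable \<B>" "topological_basis \<B>"
    using ex_countable_basis by blast
  \<comment> \<open>The distance condition shrinks the locally closed piece of \<open>V\<close> of
    rank \<open>\<eta>\<close> to a closed set; as \<open>j\<close> varies these sets exhaust each
    piece with \<open>V\<close> below rank \<open>osucc \<eta>\<close>.\<close>
  define C where "C = (\<lambda>(\<eta>, V, j :: nat).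
    {y. \<eta> \<le> r y} \<inter> {y. \<forall>z. \<not> (z \<in> V \<and> r z \<le> \<eta>) \<longrightarrow> inverse (real (Suc j)) \<le> dist y z})"
  define I where "I = {(\<eta>, V, j :: nat). \<eta> < k \<and> V \<in> \<B> \<and> (\<forall>y\<in>V. \<forall>z\<in>V. r y = \<eta> \<longrightarrow> r z = \<eta> \<longrightarrow> h y = h z)}"
  have C_sub: "y \<in> V \<and> r y = \<eta>" if "y \<in> C (\<eta>, V, j)" for y \<eta> V j
  proof -
    have "y \<in> V \<and> r y \<le> \<eta>"
    proof (rule ccontr)
      assume "\<not> (y \<in> V \<and> r y \<le> \<eta>)"
      \<comment> \<open>The point itself is taken as \<open>z\<close>, at distance zero.\<close>
      then have "inverse (real (Suc j)) \<le> dist y y" using that unfolding C_def by blast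
      then show False by (simp add: not_le del: of_nat_Suc)
    qed
    then show ?thesis using that unfolding C_def by auto
  qed
  have ex: "\<exists>i\<in>I. x \<in> C i" for x
  proof -
    obtain U where U: "open U" "x \<in> U" "\<forall>y\<in>U. r y \<le> r x" "\<forall>y\<in>U. r y = r x \<longrightarrow> h y = h x"
      using r by (rule resolvesE[where x = x])
    obtain V where V: "V \<in> \<B>" "x \<in> V" "V \<subseteq> U"
      using topological_basisE[OF \<B>(2) U(1,2)] by blast
    have "open V" using \<B>(2) V(1) by (rule topological_basis_open)
    then obtain e where e: "0 < e" "ball x e \<subseteq> V" using V(2) open_contains_ball by blast
    obtain j where j: "inverse (real (Suc j)) < e" using reals_Archimedean[OF e(1)] by blast
    have "inverse (real (Suc j)) \<le> dist x z" if "\<not> (z \<in> V \<and> r z \<le> r x)" for z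
    proof -
      have "z \<notin> V" using that V(3) U(3) by blast
      then have "z \<notin> ball x e" using e(2) by blast
      then show ?thesis using j by simp
    qed
    then have "x \<in> C (r x, V, j)" by (simp add: C_def)
    moreover have "h y = h x" if "y \<in> V" "r y = r x" for y
      using that V(3) U(4) by blast
    then have "h y = h z" if "y \<in> V" "z \<in> V" "r y = r x" "r z = r x" for y z
      using that by metis
    then have "(r x, V, j) \<in> I"
      using rk V(1) unfolding I_def by blast
    ultimately show ?thesis by blast
  qed
  have "countable {..<k}" using assms(2) by (simp add: less_omega1_iff)
  then have "countable ({..<k} \<times> \<B> \<times> (UNIV :: nat set))" using \<B>(1) by simp
  then have cI: "countable I" by (rule countable_subset[rotated]) (auto simp: I_def)
  have neI: "I \<noteq> {}" using ex by blast
  define K where "K n = C (from_nat_into I n)" for n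
  show ?thesis
  proof (rule baire1_closed_cover[of K, OF _ _ _ bdd])
    fix n
    obtain \<eta> V j where i: "from_nat_into I n = (\<eta>, V, j)" by (rule prod_cases3)
    then have inI: "(\<eta>, V, j) \<in> I" using from_nat_into[OF neI, of n] by simp
    show "closed (K n)"
      unfolding K_def i C_def prod.case by (intro closed_Int resolves_closed[OF r] closed_dist_ge)
    have const: "h y = h z" if "y \<in> K n" "z \<in> K n" for y z
    proof -
      have "\<forall>y\<in>V. \<forall>z\<in>V. r y = \<eta> \<longrightarrow> r z = \<eta> \<longrightarrow> h y = h z"
        using inI unfolding I_def by blast
      then show ?thesis using C_sub[of _ \<eta> V j] that unfolding K_def i by blast
    qed
    show "continuous_on (K n) h"
    proof (cases "K n = {}")
      case False
      then obtain z where "z \<in> K n" by blast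
      have "continuous_on (K n) (\<lambda>_. h z)" by simp
      then show ?thesis by (rule continuous_on_eq) (use const \<open>z \<in> K n\<close> in blast)
    qed simp
  next
    have "x \<in> (\<Union>n. K n)" for x
    proof -
      obtain i where i: "i \<in> I" "x \<in> C i" using ex by blast
      obtain m where "from_nat_into I m = i" using from_nat_into_surj[OF cI i(1)] by blast
      then have "x \<in> K m" using i(2) by (simp add: K_def)
      then show ?thesis by blast
    qed
    then show "(\<Union>n. K n) = UNIV" by blast
  qed
qed

section \<open>Bounds on \<open>alpha1\<close> and resolved approximations\<close>

lemma sep_rank_le_alpha1:
  fixes p q :: rat
  assumes "p < q"
  shows "sep_rank {x. f x \<le> of_rat p} {x. f x \<ge> of_rat q} \<le> alpha1 f"
  unfolding alpha1_def
proof (rule cSUP_upper2[where x = "(p, q)"])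
  show "bdd_above ((\<lambda>(p, q). sep_rank {x. f x \<le> real_of_rat p} {x. real_of_rat q \<le> f x}) ` {(p, q). p < q})"
    by (intro bdd_aboveI[where M = omega1]) (auto simp: sep_rank_le_omega1)
qed (use assms in auto)

lemma alpha1_leI:
  assumes "\<And>p q :: rat. p < q \<Longrightarrow> sep_rank {x. f x \<le> of_rat p} {x. f x \<ge> of_rat q} \<le> k"
  shows "alpha1 f \<le> k"
proof -
  have "(0, 1) \<in> {(p :: rat, q :: rat). p < q}" by simp
  then have "{(p :: rat, q :: rat). p < q} \<noteq> {}" by blast
  then show ?thesis unfolding alpha1_def using assms by (intro cSUP_least) auto
qed

lemma resolved_imp_bounded_baire1:
  fixes h :: "'a::{metric_space, second_countable_topology} \<Rightarrow> real"
  assumes h: "resolved (omega ^\<^sub>o l) h" "bounded (range h)" and l: "0 < l" "l < omega1"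
  shows "h \<in> bounded_baire1 l"
proof -
  have k: "omega ^\<^sub>o l < omega1" using l(2) by (rule opow_omega_less_omega1)
  have "alpha1 h \<le> omega ^\<^sub>o l"
  proof (rule alpha1_leI)
    fix p q :: rat assume "p < q"
    then have "altseq {x. h x \<le> of_rat p} {x. h x \<ge> of_rat q} (omega ^\<^sub>o l) = {}"
      by (intro altseq_empty_if_resolved[OF h(1) l(1)]) (use of_rat_less[of p q, where ?'a = real] in auto)
    then show "sep_rank {x. h x \<le> of_rat p} {x. h x \<ge> of_rat q} \<le> omega ^\<^sub>o l"
      by (rule sep_rank_le_if_altseq_empty[OF is_limit_opow_omega[OF l(1)] k])
  qed
  then show ?thesis
    using resolved_imp_baire1[OF h(1) k h(2)] h(2) by (simp add: bounded_baire1_def)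
qed

text \<open>Sets separating neighbouring levels of a finite grid decide in turn whether to keep the
  function built so far or to use the next grid value. Finitely many such combinations stay within
  \<open>\<omega>\<^sup>l\<close>.\<close>

lemma bounded_baire1_approx:
  fixes f :: "'a::topological_space \<Rightarrow> real"
  assumes f: "f \<in> bounded_baire1 l" and l: "l < omega1" and "0 < \<epsilon>"
  obtains h where "resolved (omega ^\<^sub>o l) h" "\<And>x. \<bar>h x - f x\<bar> \<le> \<epsilon>"
proof -
  have k: "omega ^\<^sub>o l < omega1" using l by (rule opow_omega_less_omega1)
  obtain b where b: "\<And>x. \<bar>f x\<bar> \<le> b"
    using f unfolding bounded_baire1_def bounded_iff by auto
  obtain M :: nat where M: "b < real M" using reals_Archimedean2 by blast
  obtain j where j: "inverse (real (Suc j)) < \<epsilon>" using reals_Archimedean[OF \<open>0 < \<epsilon>\<close>] by blast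
  \<comment> \<open>An inverse integer as mesh keeps the grid points rational, as
    \<open>alpha1\<close> requires.\<close>
  define \<delta> where "\<delta> = inverse (real (Suc j))"
  have \<delta>: "0 < \<delta>" "\<delta> < \<epsilon>" using j by (simp_all add: \<delta>_def)
  define p where "p i = - real M + real i * \<delta>" for i
  define p' where "p' i = - of_nat M + of_nat i * inverse (of_nat (Suc j) :: rat)" for i
  have p: "p i = of_rat (p' i)" for i
    by (simp add: p_def p'_def \<delta>_def of_rat_add of_rat_mult of_rat_minus of_rat_diff of_rat_inverse del: of_nat_Suc)
  have p_Suc: "p (Suc i) = p i + \<delta>" for i by (simp add: p_def algebra_simps)
  have "\<exists>S. resolved (omega ^\<^sub>o l) (\<lambda>x. x \<in> S) \<and> {x. f x \<le> p i} \<subseteq> S \<and> S \<inter> {x. f x \<ge> p (Suc i)} = {}" for i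
  proof -
    have "p i < p (Suc i)" using \<delta> p_Suc by simp
    then have "sep_rank {x. f x \<le> p i} {x. f x \<ge> p (Suc i)} \<le> alpha1 f"
      unfolding p of_rat_less by (rule sep_rank_le_alpha1)
    also have "\<dots> \<le> omega ^\<^sub>o l" using f by (simp add: bounded_baire1_def)
    finally show ?thesis using k by (metis sep_rank_le_imp_resolved)
  qed
  then obtain S where S: "\<And>i. resolved (omega ^\<^sub>o l) (\<lambda>x. x \<in> S i)"
    "\<And>i. {x. f x \<le> p i} \<subseteq> S i" "\<And>i. S i \<inter> {x. f x \<ge> p (Suc i)} = {}"
    by metis
  have "\<exists>h. resolved (omega ^\<^sub>o l) h \<and> (\<forall>x. f x < p (Suc i) \<longrightarrow> \<bar>h x - f x\<bar> \<le> \<delta>)" for i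
  proof (induction i)
    case 0
    have "\<bar>p 0 - f x\<bar> \<le> \<delta>" if "f x < p (Suc 0)" for x
      using that b[of x] M \<delta> p_Suc[of 0] by (simp add: p_def)
    then show ?case
      by (intro exI[of _ "\<lambda>x. p 0"] conjI resolved_const opow_omega_pos) blast
  next
    case (Suc i)
    then obtain h where h: "resolved (omega ^\<^sub>o l) h" "\<And>x. f x < p (Suc i) \<Longrightarrow> \<bar>h x - f x\<bar> \<le> \<delta>"
      by blast
    have "\<bar>(if x \<in> S i then h x else p (Suc i)) - f x\<bar> \<le> \<delta>" if "f x < p (Suc (Suc i))" for x
    proof (cases "x \<in> S i")
      case True
      then have "f x < p (Suc i)" using S(3)[of i] by force
      then show ?thesis using h(2) True by simp
    next
      case False
      \<comment> \<open>Off \<open>S i\<close> and below the new threshold, \<open>f x\<close> lies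
        within one mesh width of the middle grid point \<open>p (Suc i)\<close>.\<close>
      then have "p i < f x" using S(2)[of i] by force
      then show ?thesis using False that p_Suc[of i] p_Suc[of "Suc i"] by simp
    qed
    moreover have "resolved (omega ^\<^sub>o l) (\<lambda>x. if x \<in> S i then h x else p (Suc i))"
      using resolved_comp2[OF S(1) h(1), of "\<lambda>b u. if b then u else p (Suc i)"] .
    ultimately show ?case by blast
  qed
  \<comment> \<open>This many mesh steps lead from \<open>- M\<close> to \<open>M\<close>, and one
    more passes above all values of \<open>f\<close>.\<close>
  then obtain h where h: "resolved (omega ^\<^sub>o l) h"
    "\<And>x. f x < p (Suc (2 * M * Suc j)) \<Longrightarrow> \<bar>h x - f x\<bar> \<le> \<delta>"
    by metis
  have "real (Suc j) * \<delta> = 1" by (simp add: \<delta>_def del: of_nat_Suc)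
  then have "real (2 * M * Suc j) * \<delta> = 2 * real M"
    by (simp only: of_nat_mult of_nat_numeral mult.assoc mult_1_right)
  then have "real M < p (Suc (2 * M * Suc j))"
    using \<delta> by (simp only: p_Suc) (simp add: p_def)
  then have "\<bar>h x - f x\<bar> \<le> \<epsilon>" for x
    using h(2)[of x] b[of x] M \<delta> by linarith
  with h(1) show thesis by (rule that)
qed

section \<open>Truncation\<close>

text \<open>The function \<open>n\<close> is a rank with finite values. It certifies that, locally
  on each of its level sets, the sequence is eventually uniformly \<open>\<epsilon>\<close>-close to
  \<open>f\<close>.\<close>

definition settles :: "real \<Rightarrow> ('a::topological_space \<Rightarrow> nat) \<Rightarrow> (nat \<Rightarrow> 'a \<Rightarrow> real) \<Rightarrow> ('a \<Rightarrow> real) \<Rightarrow> bool" where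
  "settles \<epsilon> n g f \<longleftrightarrow> (\<forall>x. \<exists>U K. open U \<and> x \<in> U \<and>
     (\<forall>y\<in>U. n y \<le> n x \<and> (n y = n x \<longrightarrow> (\<forall>k\<ge>K. \<bar>g k y - f y\<bar> \<le> \<epsilon>))))"

lemma settlesI:
  assumes "\<And>x. \<exists>U K. open U \<and> x \<in> U \<and>
     (\<forall>y\<in>U. n y \<le> n x \<and> (n y = n x \<longrightarrow> (\<forall>k\<ge>K. \<bar>g k y - f y\<bar> \<le> \<epsilon>)))"
  shows "settles \<epsilon> n g f"
  unfolding settles_def using assms by (rule allI)

lemma settlesE:
  assumes "settles \<epsilon> n g f"
  obtains U K where "open U" "x \<in> U" "\<forall>y\<in>U. n y \<le> n x"
    "\<forall>y\<in>U. n y = n x \<longrightarrow> (\<forall>k\<ge>K. \<bar>g k y - f y\<bar> \<le> \<epsilon>)"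
proof -
  from assms obtain U K where "open U \<and> x \<in> U \<and>
     (\<forall>y\<in>U. n y \<le> n x \<and> (n y = n x \<longrightarrow> (\<forall>k\<ge>K. \<bar>g k y - f y\<bar> \<le> \<epsilon>)))"
    unfolding settles_def by (elim allE[of _ x] exE)
  then show thesis by (intro that[of U K]) blast+
qed

text \<open>As for pairs of resolved functions, equality of the sums of ranks forces equality of
  both ranks near \<open>x\<close>.\<close>

lemma settles_add:
  assumes "settles \<epsilon> n g f" "settles \<epsilon>' n' g' f'"
  shows "settles (\<epsilon> + \<epsilon>') (\<lambda>x. n x + n' x) (\<lambda>k x. g k x + g' k x) (\<lambda>x. f x + f' x)"
proof (rule settlesI)
  fix x
  obtain U K where U: "open U" "x \<in> U" "\<forall>y\<in>U. n y \<le> n x"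
    "\<forall>y\<in>U. n y = n x \<longrightarrow> (\<forall>k\<ge>K. \<bar>g k y - f y\<bar> \<le> \<epsilon>)"
    using assms(1) by (rule settlesE[where x = x])
  obtain U' K' where U': "open U'" "x \<in> U'" "\<forall>y\<in>U'. n' y \<le> n' x"
    "\<forall>y\<in>U'. n' y = n' x \<longrightarrow> (\<forall>k\<ge>K'. \<bar>g' k y - f' y\<bar> \<le> \<epsilon>')"
    using assms(2) by (rule settlesE[where x = x])
  show "\<exists>U K. open U \<and> x \<in> U \<and> (\<forall>y\<in>U. n y + n' y \<le> n x + n' x \<and>
      (n y + n' y = n x + n' x \<longrightarrow> (\<forall>k\<ge>K. \<bar>g k y + g' k y - (f y + f' y)\<bar> \<le> \<epsilon> + \<epsilon>')))"
  proof (intro exI[of _ "U \<inter> U'"] exI[of _ "max K K'"] conjI ballI impI allI)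
    fix y assume "y \<in> U \<inter> U'"
    then have y: "y \<in> U" "y \<in> U'" by auto
    then have le: "n y \<le> n x" "n' y \<le> n' x" using U(3) U'(3) by blast+
    then show "n y + n' y \<le> n x + n' x" by simp
    fix k assume "n y + n' y = n x + n' x" and k: "max K K' \<le> k"
    then have "n y = n x" "n' y = n' x" using le by simp_all
    then have "\<bar>g k y - f y\<bar> \<le> \<epsilon>" "\<bar>g' k y - f' y\<bar> \<le> \<epsilon>'"
      using y k U(4) U'(4) by auto
    then show "\<bar>g k y + g' k y - (f y + f' y)\<bar> \<le> \<epsilon> + \<epsilon>'" by linarith
  qed (use U U' in auto)
qed

lemma settles_sum:
  fixes m :: nat
  assumes "\<And>i. i < m \<Longrightarrow> settles 0 (n i) (g i) (f i)"
  shows "settles 0 (\<lambda>x. \<Sum>i<m. n i x) (\<lambda>k x. \<Sum>i<m. g i k x) (\<lambda>x. \<Sum>i<m. f i x)"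
  using assms
proof (induction m)
  case 0
  then show ?case by (intro settlesI exI[of _ UNIV]) simp
next
  case (Suc m)
  have "settles 0 (\<lambda>x. \<Sum>i<m. n i x) (\<lambda>k x. \<Sum>i<m. g i k x) (\<lambda>x. \<Sum>i<m. f i x)"
    "settles 0 (n m) (g m) (f m)"
    using Suc by simp_all
  from settles_add[OF this] show ?case by simp
qed

text \<open>
  Write the rank as \<open>k * n + \<rho>\<close>. On \<open>{n = m}\<close> keep \<open>h\<close> only on the closed set of points at distance
  at least \<open>1 / (j + 1)\<close> from \<open>{k * m + \<delta> j \<le> R}\<close>. Such a piece lies in \<open>{\<rho> < \<delta> j}\<close>, and the
  pieces for different \<open>m\<close> are disjoint and form a locally finite family.
\<close>

lemma resolved_truncate:
  fixes h :: "'a::metric_space \<Rightarrow> real"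
  assumes h: "resolved (k * omega) h"
    and \<delta>: "mono \<delta>" "\<And>j. is_limit (\<delta> j)" "\<And>j. \<delta> j \<le> k" "\<And>\<rho>. \<rho> < k \<Longrightarrow> \<exists>j. \<rho> < \<delta> j"
  shows "\<exists>g n. (\<forall>j. resolved (\<delta> j) (g j)) \<and> (\<forall>j x. g j x = h x \<or> g j x = 0) \<and> settles 0 n g h"
proof -
  obtain R where R_less: "\<forall>x. R x < k * omega" and R: "resolves R h"
    using h by (rule resolvedE)
  have "\<forall>x. \<exists>m \<rho>. R x = k * ord_of_nat m + \<rho> \<and> \<rho> < k"
    using R_less times_omega_div by metis
  then obtain n \<rho> where n: "\<And>x. R x = k * ord_of_nat (n x) + \<rho> x" and \<rho>: "\<And>x. \<rho> x < k"
    by metis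
  have n_less: "R x < k * ord_of_nat m" if "n x < m" for x m
    using times_nat_add_less[OF \<rho> that] n by simp
  have n_le: "k * ord_of_nat m \<le> R x" if "m \<le> n x" for x m
    unfolding n[of x] by (rule order_trans[OF times_nat_le[OF that] ord_le_add_left])
  have n_mono: "n y \<le> n x" if "R y \<le> R x" for x y
    using n_less[of x "n y"] n_le[of "n y" y] that by (meson leD leI order_refl order_trans)
  define C where "C j m = {x. k * ord_of_nat m \<le> R x} \<inter>
    {x. \<forall>z. k * ord_of_nat m + \<delta> j \<le> R z \<longrightarrow> inverse (real (Suc j)) \<le> dist x z}" for j m
  have C_closed: "closed (C j m)" for j m
    unfolding C_def by (intro closed_Int resolves_closed[OF R] closed_dist_ge)
  have C_n: "n x = m" "\<rho> x < \<delta> j" if "x \<in> C j m" for x j m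
  proof -
    have less: "R x < k * ord_of_nat m + \<delta> j"
    proof (rule ccontr)
      assume "\<not> R x < k * ord_of_nat m + \<delta> j"
      then have "k * ord_of_nat m + \<delta> j \<le> R x" by (simp only: not_less)
      then have "inverse (real (Suc j)) \<le> dist x x" using that unfolding C_def by blast
      then show False by (simp add: not_le del: of_nat_Suc)
    qed
    also have "\<dots> \<le> k * ord_of_nat (Suc m)" using \<delta>(3) by simp
    finally have "\<not> Suc m \<le> n x" using n_le[of "Suc m" x] by auto
    moreover have "\<not> n x < m" using n_less[of x m] that unfolding C_def by auto
    ultimately show "n x = m" by simp
    then show "\<rho> x < \<delta> j" using less n[of x] by simp
  qed
  define g where "g j x = (if x \<in> C j (n x) then h x else 0)" for j x
  \<comment> \<open>The shift by one reserves rank \<open>0\<close> for points outside the pieces;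
    since \<open>\<delta> j\<close> is a limit, the shifted rank remains below it.\<close>
  define s where "s j x = (if x \<in> C j (n x) then osucc (\<rho> x) else 0)" for j x
  have "resolved (\<delta> j) (g j)" for j
  proof (rule resolvedI[of "s j"])
    show "s j x < \<delta> j" for x
      using C_n(2)[of x j "n x"] \<delta>(2)[of j] by (simp add: s_def is_limit_osucc_less is_limit_pos)
    show "resolves (s j) (g j)"
    proof (rule resolvesI)
      fix x
      obtain U where U: "open U" "x \<in> U" "\<forall>y\<in>U. R y \<le> R x" "\<forall>y\<in>U. R y = R x \<longrightarrow> h y = h x"
        using R by (rule resolvesE[where x = x])
      \<comment> \<open>Only finitely many pieces have index at most \<open>n x\<close>. Removing
        those that miss \<open>x\<close> leaves at most the piece containing \<open>x\<close>, as
        larger indices do not occur in \<open>U\<close>.\<close>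
      define Z where "Z = (\<Union>m\<in>{m. m \<le> n x \<and> x \<notin> C j m}. C j m)"
      have "closed Z" unfolding Z_def using C_closed by (intro closed_UN) auto
      have in_C: "n y = n x \<and> x \<in> C j (n x)" if "y \<in> U - Z" "y \<in> C j (n y)" for y
      proof -
        have "n y \<le> n x" using U(3) that n_mono by blast
        then have "x \<in> C j (n y)" using that unfolding Z_def by blast
        then show ?thesis using C_n(1) by metis
      qed
      show "\<exists>U. open U \<and> x \<in> U \<and> (\<forall>y\<in>U. s j y \<le> s j x \<and> (s j y = s j x \<longrightarrow> g j y = g j x))"
      proof (intro exI[of _ "U - Z"] conjI ballI)
        show "open (U - Z)" using U(1) \<open>closed Z\<close> by (rule open_Diff)
        show "x \<in> U - Z" using U(2) unfolding Z_def by blast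
        fix y assume y: "y \<in> U - Z"
        have "s j y \<le> s j x \<and> (s j y = s j x \<longrightarrow> g j y = g j x)"
        proof (cases "y \<in> C j (n y)")
          case True
          then have x: "n y = n x" "x \<in> C j (n x)" using in_C y by blast+
          have "R y \<le> R x" using U(3) y by blast
          then have "\<rho> y \<le> \<rho> x" using n[of x] n[of y] x(1) by simp
          moreover have "h y = h x" if "\<rho> y = \<rho> x"
            using U(4) y n[of x] n[of y] x(1) that by simp
          ultimately show ?thesis using True x(2) by (simp add: s_def g_def)
        next
          case False
          then show ?thesis by (auto simp: s_def g_def)
        qed
        then show "s j y \<le> s j x" "s j y = s j x \<longrightarrow> g j y = g j x" by blast+
      qed
    qed
  qed
  moreover have "settles 0 n g h"
  proof (rule settlesI)
    fix x
    obtain U where U: "open U" "x \<in> U" "\<forall>y\<in>U. R y \<le> R x" "\<forall>y\<in>U. R y = R x \<longrightarrow> h y = h x"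
      using R by (rule resolvesE[where x = x])
    obtain i where i: "\<rho> x < \<delta> i" using \<delta>(4)[OF \<rho>[of x]] by blast
    define T where "T = {z. k * ord_of_nat (n x) + \<delta> i \<le> R z}"
    have "open (- T)" unfolding T_def using resolves_closed[OF R] by (simp add: open_Compl)
    moreover have "x \<in> - T" unfolding T_def using i n[of x] by simp
    ultimately obtain e where e: "0 < e" "ball x e \<subseteq> - T" using open_contains_ball by blast
    \<comment> \<open>Halving \<open>e\<close> keeps every \<open>y\<close> in the smaller ball at
      distance at least \<open>e / 2\<close> from \<open>T\<close>, which exceeds the cutoff for
      indices from \<open>l\<close> on.\<close>
    obtain l where l: "inverse (real (Suc l)) < e / 2" using reals_Archimedean[of "e / 2"] e(1) by auto
    show "\<exists>U K. open U \<and> x \<in> U \<and> (\<forall>y\<in>U. n y \<le> n x \<and> (n y = n x \<longrightarrow> (\<forall>k\<ge>K. \<bar>g k y - h y\<bar> \<le> 0)))"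
    proof (intro exI[of _ "U \<inter> ball x (e / 2)"] exI[of _ "max i l"] conjI ballI impI allI)
      show "open (U \<inter> ball x (e / 2))" "x \<in> U \<inter> ball x (e / 2)" using U(1,2) e(1) by auto
      fix y assume y: "y \<in> U \<inter> ball x (e / 2)"
      then show "n y \<le> n x" using U(3) n_mono by blast
      fix j assume ny: "n y = n x" and j: "max i l \<le> j"
      have "inverse (real (Suc j)) \<le> dist y z" if z: "k * ord_of_nat (n x) + \<delta> j \<le> R z" for z
      proof -
        have "\<delta> i \<le> \<delta> j" using j monoD[OF \<delta>(1)] by simp
        then have "k * ord_of_nat (n x) + \<delta> i \<le> R z" using z by (meson ord_add_le_iff order_trans)
        then have "z \<notin> ball x e" using e(2) unfolding T_def by blast
        then have "e \<le> dist x z" by simp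
        also have "\<dots> \<le> dist x y + dist y z" by (rule dist_triangle)
        also have "dist x y < e / 2" using y by simp
        finally have "e / 2 \<le> dist y z" by simp
        moreover have "inverse (real (Suc j)) \<le> inverse (real (Suc l))"
          using j by (intro le_imp_inverse_le) auto
        ultimately show ?thesis using l by linarith
      qed
      then have "y \<in> C j (n y)" unfolding C_def ny using n_le[of "n y" y] ny by simp
      then show "\<bar>g j y - h y\<bar> \<le> 0" by (simp add: g_def)
    qed
  qed
  moreover have "g j x = h x \<or> g j x = 0" for j x by (simp add: g_def)
  ultimately show ?thesis by blast
qed

text \<open>Running maxima of an enumeration of the countable set of ordinals below \<open>l\<close>
  are monotone and cofinal enough to reach every bound.\<close>

lemma opow_omega_cofinal_seq:
  assumes "0 < l" "l < omega1"
  shows "\<exists>\<eta> :: nat \<Rightarrow> ordinal. (\<forall>k. \<eta> k < l) \<and> mono \<eta> \<and>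
    (\<forall>\<rho> < omega ^\<^sub>o l. \<exists>k. \<rho> < omega ^\<^sub>o osucc (\<eta> k))"
proof -
  have c: "countable {..<l}" "{..<l} \<noteq> {}" using assms by (auto simp: less_omega1_iff)
  define e where "e = from_nat_into {..<l}"
  define \<eta> where "\<eta> k = Max (e ` {..k})" for k
  have e_less: "e k < l" for k using from_nat_into[OF c(2), of k] by (simp add: e_def)
  show ?thesis
  proof (intro exI[of _ \<eta>] conjI allI impI)
    show "\<eta> k < l" for k using e_less by (simp add: \<eta>_def)
    show "mono \<eta>" unfolding \<eta>_def by (intro monoI Max_mono) auto
    fix \<rho> assume "\<rho> < omega ^\<^sub>o l"
    then obtain a where a: "a < l" "\<rho> < omega ^\<^sub>o osucc a" using opow_omega_cofinal assms(1) by blast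
    obtain k where "e k = a" using from_nat_into_surj[OF c(1), of a] a(1) unfolding e_def by auto
    then have "a \<le> \<eta> k" unfolding \<eta>_def by (intro Max_ge) auto
    then have "omega ^\<^sub>o osucc a \<le> omega ^\<^sub>o osucc (\<eta> k)" by (intro opow_omega_le) simp
    with a(2) show "\<exists>k. \<rho> < omega ^\<^sub>o osucc (\<eta> k)" by (meson less_le_trans)
  qed
qed

section \<open>Functions of class \<open>\<lambda> + 1\<close> as pseudouniform limits\<close>

text \<open>At a point of the \<open>m\<close>-th derivative with rank \<open>m\<close>, nearby
  points of that derivative also have rank \<open>m\<close>. Both functions compared there are
  \<open>\<epsilon>\<close>-close to \<open>f\<close>, so the oscillation is at most
  \<open>2 * \<epsilon>\<close> and the point is removed.\<close>

lemma iter_deriv_settles_subset: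
  assumes "settles \<epsilon> n g f" "2 * \<epsilon> < \<epsilon>'" "0 < \<epsilon>'"
  shows "iter_deriv (osc_deriv g \<epsilon>') (ord_of_nat m) UNIV \<subseteq> {x. m \<le> n x}"
proof (induction m)
  case (Suc m)
  let ?E = "iter_deriv (osc_deriv g \<epsilon>') (ord_of_nat m) UNIV"
  show ?case
  proof (rule subsetI, rule ccontr)
    fix x assume "x \<in> iter_deriv (osc_deriv g \<epsilon>') (ord_of_nat (Suc m)) UNIV"
      and less: "x \<notin> {x. Suc m \<le> n x}"
    then have x: "x \<in> ?E" "ennreal \<epsilon>' \<le> osc g x ?E" by (simp_all add: osc_deriv_def)
    then have nx: "n x = m" using less Suc by auto
    obtain U K where U: "open U" "x \<in> U" "\<forall>y\<in>U. n y \<le> n x"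
      "\<forall>y\<in>U. n y = n x \<longrightarrow> (\<forall>k\<ge>K. \<bar>g k y - f y\<bar> \<le> \<epsilon>)"
      using assms(1) by (rule settlesE[where x = x])
    have diff: "\<bar>g i y - g j y\<bar> \<le> 2 * \<epsilon>" if "K \<le> i" "K \<le> j" "y \<in> U \<inter> ?E" for i j y
    proof -
      have "m \<le> n y" using that Suc by blast
      moreover have "n y \<le> m" using that U(3) nx by blast
      ultimately have "\<bar>g i y - f y\<bar> \<le> \<epsilon>" "\<bar>g j y - f y\<bar> \<le> \<epsilon>" using that U(4) nx by auto
      then show ?thesis by linarith
    qed
    have "osc g x ?E \<le> (SUP (i, j, y)\<in>{K..} \<times> {K..} \<times> (U \<inter> ?E). ennreal \<bar>g i y - g j y\<bar>)"
      unfolding osc_def using U(1,2) by (intro INF_lower2[where i = U] INF_lower) auto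
    also have "\<dots> \<le> ennreal (2 * \<epsilon>)"
      using diff by (intro SUP_least) (auto intro!: ennreal_leI)
    also have "\<dots> < ennreal \<epsilon>'" using assms(2,3) by (simp add: ennreal_lessI)
    finally show False using x(2) by simp
  qed
qed simp

lemma settles_imp_pseudouniformly_convergent:
  assumes "\<And>\<epsilon>. 0 < \<epsilon> \<Longrightarrow> \<exists>n. settles \<epsilon> n g f"
  shows "pseudouniformly_convergent g"
proof -
  have "deriv_rank (osc_deriv g \<epsilon>) \<le> omega" if "0 < \<epsilon>" for \<epsilon>
  proof -
    have "0 < \<epsilon> / 3" using that by simp
    then obtain n where n: "settles (\<epsilon> / 3) n g f" using assms by blast
    have "iter_deriv (osc_deriv g \<epsilon>) omega UNIV = {}"
    proof (rule ccontr)
      assume "iter_deriv (osc_deriv g \<epsilon>) omega UNIV \<noteq> {}"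
      then obtain x where "x \<in> (\<Inter>\<eta>\<in>{..<omega}. iter_deriv (osc_deriv g \<epsilon>) \<eta> UNIV)"
        using is_limit_omega by auto
      \<comment> \<open>Each point is gone one step after its finite rank, so nothing remains at
        \<open>omega\<close>.\<close>
      then have "x \<in> iter_deriv (osc_deriv g \<epsilon>) (ord_of_nat (Suc (n x))) UNIV"
        using ord_of_nat_less_omega by blast
      then show False
        using iter_deriv_settles_subset[OF n, of \<epsilon> "Suc (n x)"] that by auto
    qed
    then show ?thesis
      unfolding deriv_rank_def using omega_less_omega1 by (auto intro: Least_le)
  qed
  then show ?thesis
    unfolding pseudouniformly_convergent_def gamma_rank_def by (intro cSUP_least) auto
qed

lemma settles_imp_tendsto:
  assumes "\<And>\<epsilon>. 0 < \<epsilon> \<Longrightarrow> \<exists>n. settles \<epsilon> n g f"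
  shows "(\<lambda>k. g k x) \<longlonglongrightarrow> f x"
proof (rule LIMSEQ_I)
  fix e :: real assume "0 < e"
  then have "0 < e / 2" by simp
  then obtain n where "settles (e / 2) n g f" using assms by blast
  then obtain U K where "x \<in> U" "\<forall>y\<in>U. n y = n x \<longrightarrow> (\<forall>k\<ge>K. \<bar>g k y - f y\<bar> \<le> e / 2)"
    by (rule settlesE[where x = x])
  then have "\<forall>k\<ge>K. \<bar>g k x - f x\<bar> \<le> e / 2" by blast
  then show "\<exists>K. \<forall>k\<ge>K. norm (g k x - f x) < e" using \<open>0 < e\<close> by (intro exI[of _ K]) force
qed

text \<open>Keeping the exact geometric difference on the right lets the induction close.\<close>

lemma sum_geometric_tail:
  fixes a :: "nat \<Rightarrow> real"
  assumes a: "\<And>j. \<bar>a j\<bar> \<le> c * (1 / 2) ^ j" and "m \<le> k"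
  shows "\<bar>(\<Sum>j<k. a j) - (\<Sum>j<m. a j)\<bar> \<le> 2 * c * ((1 / 2) ^ m - (1 / 2) ^ k)"
  using \<open>m \<le> k\<close>
proof (induction k rule: dec_induct)
  case (step k)
  have "\<bar>a k\<bar> \<le> c * (1 / 2) ^ k" by (rule a)
  with step.IH show ?case by (simp add: algebra_simps)
qed simp

text \<open>
  The telescoping series of resolved approximations to \<open>f\<close> is truncated both termwise, to lower the
  rank, and in its length; the terms decay geometrically, so only finitely many of the rank functions
  matter for each precision.
\<close>

lemma bounded_baire1_settles:
  fixes f :: "'a::{metric_space, second_countable_topology} \<Rightarrow> real"
  assumes f: "f \<in> bounded_baire1 (osucc l)" and l: "0 < l" "l < omega1"
  shows "\<exists>g \<eta>. (\<forall>k. \<eta> k < l) \<and> (\<forall>k. g k \<in> bounded_baire1 (osucc (\<eta> k))) \<and>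
    (\<forall>\<epsilon>>0. \<exists>n. settles \<epsilon> n g f)"
proof -
  obtain \<eta> :: "nat \<Rightarrow> ordinal" where seq: "(\<forall>k. \<eta> k < l) \<and> mono \<eta> \<and>
      (\<forall>\<rho> < omega ^\<^sub>o l. \<exists>k. \<rho> < omega ^\<^sub>o osucc (\<eta> k))"
    using opow_omega_cofinal_seq[OF l] by (rule exE)
  then have \<eta>: "\<And>k. \<eta> k < l" "mono \<eta>"
    "\<And>\<rho>. \<rho> < omega ^\<^sub>o l \<Longrightarrow> \<exists>k. \<rho> < omega ^\<^sub>o osucc (\<eta> k)"
    by blast+
  have "\<exists>h. resolved (omega ^\<^sub>o osucc l) h \<and> (\<forall>x. \<bar>h x - f x\<bar> \<le> (1 / 2) ^ j)" for j :: nat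
    using bounded_baire1_approx[OF f osucc_less_omega1[OF l(2)], of "(1 / 2) ^ j"] by auto
  then obtain h where h: "\<And>j. resolved (omega ^\<^sub>o osucc l) (h j)"
    "\<And>j x. \<bar>h j x - f x\<bar> \<le> (1 / 2) ^ j"
    by metis
  obtain b where b: "\<And>x. \<bar>f x\<bar> \<le> b"
    using f unfolding bounded_baire1_def bounded_iff by auto
  define d where "d j x = h j x - (if j = 0 then 0 else h (j - 1) x)" for j x
  have sum_d: "(\<Sum>j<Suc J. d j x) = h J x" for J x
    by (induction J) (simp_all add: d_def)
  \<comment> \<open>The initial term is bounded by \<open>b + 1\<close> and each later one by three
    times its power of \<open>1 / 2\<close>; \<open>c\<close> covers both.\<close>
  define c where "c = b + 4"
  have c: "4 \<le> c" using b[of undefined] unfolding c_def by linarith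
  have d_le: "\<bar>d j x\<bar> \<le> c * (1 / 2) ^ j" for j x
  proof (cases j)
    case 0
    then show ?thesis using h(2)[of 0 x] b[of x] by (simp add: d_def c_def)
  next
    case (Suc i)
    have "\<bar>d j x\<bar> \<le> \<bar>h j x - f x\<bar> + \<bar>h i x - f x\<bar>" by (simp add: d_def Suc)
    also have "\<dots> \<le> (1 / 2) ^ j + (1 / 2) ^ i" by (intro add_mono h(2))
    also have "\<dots> = 3 * (1 / 2) ^ j" by (simp add: Suc)
    also have "\<dots> \<le> c * (1 / 2) ^ j" using c by (intro mult_right_mono) auto
    finally show ?thesis .
  qed
  have d_res: "resolved (omega ^\<^sub>o l * omega) (d j)" for j
  proof (cases j)
    case 0
    then show ?thesis using h(1)[of 0] by (simp add: d_def[abs_def])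
  next
    case (Suc i)
    then show ?thesis using resolved_comp2[OF h(1) h(1), of "(-)" j i] by (simp add: d_def[abs_def])
  qed
  define \<delta> where "\<delta> j = omega ^\<^sub>o osucc (\<eta> j)" for j
  have "mono \<delta>"
    using \<eta>(2) unfolding \<delta>_def by (intro monoI opow_omega_le) (simp add: monoD)
  moreover have "is_limit (\<delta> j)" for j
    unfolding \<delta>_def by (rule is_limit_opow_omega) (simp add: ord_zero_less_iff)
  moreover have "\<delta> j \<le> omega ^\<^sub>o l" for j
    unfolding \<delta>_def using \<eta>(1) by (intro opow_omega_le) (simp add: osucc_le_iff)
  ultimately have "\<exists>t n. (\<forall>k. resolved (\<delta> k) (t k)) \<and> (\<forall>k x. t k x = d j x \<or> t k x = 0) \<and> settles 0 n t (d j)" for j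
    using \<eta>(3) unfolding \<delta>_def[symmetric] by (intro resolved_truncate[OF d_res])
  then obtain t n where t: "\<And>j k. resolved (\<delta> k) (t j k)" "\<And>j k x. t j k x = d j x \<or> t j k x = 0"
    "\<And>j. settles 0 (n j) (t j) (d j)"
    by metis
  have t_le: "\<bar>t j k x\<bar> \<le> c * (1 / 2) ^ j" for j k x
  proof -
    have "\<bar>t j k x\<bar> \<le> \<bar>d j x\<bar>" using t(2)[of j k x] by auto
    then show ?thesis using d_le order_trans by blast
  qed
  \<comment> \<open>All terms of the \<open>k\<close>-th function use the same truncation index, so
    one power of \<open>omega\<close> bounds their common rank.\<close>
  define g where "g k x = (\<Sum>j<k. t j k x)" for k x
  have tail: "\<bar>g k x - (\<Sum>j<m. t j k x)\<bar> \<le> 2 * c * (1 / 2) ^ m" if "m \<le> k" for m k x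
  proof -
    have "\<bar>g k x - (\<Sum>j<m. t j k x)\<bar> \<le> 2 * c * ((1 / 2) ^ m - (1 / 2) ^ k)"
      unfolding g_def by (rule sum_geometric_tail[OF t_le that])
    also have "\<dots> \<le> 2 * c * (1 / 2) ^ m" using c by (intro mult_left_mono) auto
    finally show ?thesis .
  qed
  show ?thesis
  proof (intro exI[of _ g] exI[of _ \<eta>] conjI allI impI)
    fix k
    show "\<eta> k < l" by (rule \<eta>(1))
    have "resolved (omega ^\<^sub>o osucc (\<eta> k)) (g k)"
      unfolding g_def using t(1) by (intro resolved_sum) (simp add: \<delta>_def)
    moreover have "bounded (range (g k))"
      unfolding bounded_iff using tail[of 0 k] by auto
    moreover have "osucc (\<eta> k) < omega1"
      using \<eta>(1) l(2) less_trans osucc_less_omega1 by blast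
    ultimately show "g k \<in> bounded_baire1 (osucc (\<eta> k))"
      by (intro resolved_imp_bounded_baire1) (simp_all add: ord_zero_less_iff)
  next
    fix \<epsilon> :: real assume "0 < \<epsilon>"
    then have "0 < \<epsilon> / (c + 1)" using c by simp
    \<comment> \<open>Dropping the terms beyond \<open>J\<close> costs at most
      \<open>c * (1 / 2) ^ J\<close>, and replacing \<open>f\<close> by \<open>h J\<close> costs one
      more such power.\<close>
    then obtain J where J: "(1 / 2) ^ J < \<epsilon> / (c + 1)"
      using real_arch_pow_inv[of "\<epsilon> / (c + 1)" "1 / 2"] by auto
    define N where "N x = (\<Sum>j<Suc J. n j x)" for x
    have "settles 0 N (\<lambda>k x. \<Sum>j<Suc J. t j k x) (\<lambda>x. \<Sum>j<Suc J. d j x)"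
      unfolding N_def by (rule settles_sum) (rule t(3))
    then have S: "settles 0 N (\<lambda>k x. \<Sum>j<Suc J. t j k x) (h J)" unfolding sum_d .
    have "settles \<epsilon> N g f"
    proof (rule settlesI)
      fix x
      obtain U K where U: "open U" "x \<in> U" "\<forall>y\<in>U. N y \<le> N x"
        "\<forall>y\<in>U. N y = N x \<longrightarrow> (\<forall>k\<ge>K. \<bar>(\<Sum>j<Suc J. t j k y) - h J y\<bar> \<le> 0)"
        using S by (rule settlesE[where x = x])
      have "\<bar>g k y - f y\<bar> \<le> \<epsilon>" if "y \<in> U" "N y = N x" "max K (Suc J) \<le> k" for k y
      proof -
        have "\<bar>(\<Sum>j<Suc J. t j k y) - h J y\<bar> \<le> 0" using U(4) that by simp
        moreover have "\<bar>g k y - (\<Sum>j<Suc J. t j k y)\<bar> \<le> 2 * c * (1 / 2) ^ Suc J"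
          using that by (intro tail) simp
        moreover have "\<bar>h J y - f y\<bar> \<le> (1 / 2) ^ J" by (rule h(2))
        moreover have "(c + 1) * (1 / 2) ^ J < \<epsilon>" using J c by (simp add: field_simps)
        ultimately show ?thesis by (simp add: algebra_simps)
      qed
      then show "\<exists>U K. open U \<and> x \<in> U \<and>
          (\<forall>y\<in>U. N y \<le> N x \<and> (N y = N x \<longrightarrow> (\<forall>k\<ge>K. \<bar>g k y - f y\<bar> \<le> \<epsilon>)))"
        using U(1-3) by blast
    qed
    then show "\<exists>n. settles \<epsilon> n g f" by blast
  qed
qed

section \<open>Pseudouniform limits\<close>

text \<open>Restarted at \<open>b\<close>, the alternating sequence shrinks inside \<open>U\<close>
  at least as fast as any sequence separating larger sets. The restart stage preserves
  parity.\<close>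

lemma altseq_add_subset:
  assumes F: "diff_seq \<mu> F" "separates \<mu> F A' B'" and U: "open U" and b: "b = 0 \<or> is_limit b"
    and A: "altseq A B b \<inter> U \<inter> A \<subseteq> A'" and B: "altseq A B b \<inter> U \<inter> B \<subseteq> B'"
  shows "altseq A B (b + a) \<inter> U \<subseteq> F a"
proof (induction a rule: ord_induct)
  case zero
  then show ?case using F(1) by (simp add: diff_seq_def)
next
  case (osucc a)
  let ?P = "if ord_even a then B else A"
  have "altseq A B (b + a) \<inter> ?P \<inter> U \<subseteq> F (osucc a)"
  proof
    fix x assume x: "x \<in> altseq A B (b + a) \<inter> ?P \<inter> U"
    then have "x \<in> F a" using osucc by blast
    moreover have "x \<in> altseq A B b" using x altseq_antimono[OF ord_le_add_left, of A B b a] by blast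
    then have "x \<in> (if ord_even a then B' else A')" using x A B by (auto split: if_splits)
    ultimately show "x \<in> F (osucc a)"
      using diff_seq_parity[OF F, of x a] by (auto split: if_splits)
  qed
  then have "closure (altseq A B (b + a) \<inter> ?P \<inter> U) \<subseteq> F (osucc a)"
    using diff_seq_closed[OF F(1)] by (rule closure_minimal)
  \<comment> \<open>Openness of \<open>U\<close> lets the closure be tested inside
    \<open>U\<close>.\<close>
  moreover have "U \<inter> closure (altseq A B (b + a) \<inter> ?P) \<subseteq> closure (U \<inter> (altseq A B (b + a) \<inter> ?P))"
    using U by (rule open_Int_closure_subset)
  moreover have "altseq A B (b + osucc a) = closure (altseq A B (b + a) \<inter> ?P)"
    using ord_even_add[OF b, of a] by simp
  ultimately show ?case by (simp only: Int_ac)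
next
  case (limit a)
  have "altseq A B (b + a) \<inter> U \<subseteq> F c" if "c < a" for c
    using limit(2)[OF that] altseq_antimono[of "b + c" "b + a" A B] ord_add_le_iff that less_imp_le
    by blast
  then have sub: "altseq A B (b + a) \<inter> U \<subseteq> (\<Inter>c\<in>{..<a}. F c)" by blast
  \<comment> \<open>Continuity handles limits inside the sequence; at its end the intersection is
    empty, and beyond it \<open>F \<mu>\<close> is.\<close>
  consider "a < \<mu>" | "a = \<mu>" | "\<mu> < a" by fastforce
  then show ?case
  proof cases
    case 3
    then have "altseq A B (b + a) \<inter> U \<subseteq> F \<mu>" using sub by blast
    then show ?thesis using F(1) by (simp add: diff_seq_def)
  qed (use sub F(1) limit(1) in \<open>simp_all add: diff_seq_def\<close>)
qed

text \<open>Each derivative step is matched by \<open>\<omega>\<^sup>l\<close> stages of the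
  alternating sequence: near a point leaving the derivative, one \<open>g N\<close> approximates
  \<open>f\<close> uniformly, so the separating sequence for \<open>g N\<close> removes that
  point.\<close>

lemma Phi_alpha1_le:
  fixes f :: "'a::topological_space \<Rightarrow> real"
  assumes g: "\<And>k. alpha1 (g k) \<le> omega ^\<^sub>o l" and conv: "pseudouniformly_convergent g"
    and lim: "\<And>x. (\<lambda>k. g k x) \<longlonglongrightarrow> f x" and l: "0 < l" "l < omega1"
  shows "alpha1 f \<le> omega ^\<^sub>o osucc l"
proof (rule alpha1_leI)
  fix p q :: rat assume "p < q"
  let ?k = "omega ^\<^sub>o l"
  let ?A = "{x. f x \<le> of_rat p}" and ?B = "{x. f x \<ge> of_rat q}"
  \<comment> \<open>The middle third between \<open>p\<close> and \<open>q\<close> accommodates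
    rationals \<open>p' < q'\<close>, leaving an error margin of \<open>\<epsilon>\<close> on either
    side.\<close>
  define \<epsilon> where "\<epsilon> = (of_rat q - of_rat p :: real) / 3"
  have "(of_rat p :: real) < of_rat q" using \<open>p < q\<close> by (simp add: of_rat_less)
  then have \<epsilon>: "0 < \<epsilon>" "of_rat p + \<epsilon> < of_rat q - \<epsilon>" by (simp_all add: \<epsilon>_def field_simps)
  obtain p' :: rat where p': "of_rat p + \<epsilon> < of_rat p'" "of_rat p' < of_rat q - \<epsilon>"
    using of_rat_dense[OF \<epsilon>(2)] by blast
  obtain q' :: rat where q': "of_rat p' < (of_rat q' :: real)" "of_rat q' < of_rat q - \<epsilon>"
    using of_rat_dense[OF p'(2)] by blast
  have k: "is_limit ?k" "?k < omega1" using l by (simp_all add: is_limit_opow_omega opow_omega_less_omega1)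
  let ?D = "osc_deriv g \<epsilon>"
  \<comment> \<open>Every restart stage must be zero or a limit, which holds since
    \<open>\<omega>\<^sup>l\<close> is a limit.\<close>
  have limit_stage: "?k * ord_of_nat m = 0 \<or> is_limit (?k * ord_of_nat m)" for m
    using is_limit_add[OF k(1)] by (cases m) (simp_all del: plus_ordinal.simps(3))
  have main: "altseq ?A ?B (?k * ord_of_nat m) \<subseteq> iter_deriv ?D (ord_of_nat m) UNIV" for m
  proof (induction m)
    case (Suc m)
    let ?E = "iter_deriv ?D (ord_of_nat m) UNIV" and ?b = "?k * ord_of_nat m"
    show ?case
    proof (rule subsetI, rule ccontr)
      fix x assume x: "x \<in> altseq ?A ?B (?k * ord_of_nat (Suc m))"
        and "x \<notin> iter_deriv ?D (ord_of_nat (Suc m)) UNIV"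
      moreover have "x \<in> ?E" using x altseq_antimono[OF times_nat_le, of m "Suc m"] Suc by (meson le_SucI order_refl subsetD)
      ultimately have "osc g x ?E < ennreal \<epsilon>" by (simp add: osc_deriv_def not_le)
      then obtain U N where U: "open U" "x \<in> U"
        and "(SUP (i, j, y)\<in>{N..} \<times> {N..} \<times> (U \<inter> ?E). ennreal \<bar>g i y - g j y\<bar>) < ennreal \<epsilon>"
        unfolding osc_def by (auto simp: INF_less_iff)
      then have "ennreal \<bar>g i y - g j y\<bar> < ennreal \<epsilon>" if "N \<le> i" "N \<le> j" "y \<in> U" "y \<in> ?E" for i j y
        using that by (auto elim!: le_less_trans[rotated] intro!: SUP_upper2[where i = "(i, j, y)"])
      then have diff: "\<bar>g i y - g N y\<bar> \<le> \<epsilon>" if "N \<le> i" "y \<in> U" "y \<in> ?E" for i y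
        using that \<epsilon>(1) by (metis abs_ge_zero ennreal_less_iff less_imp_le order_refl)
      have close: "\<bar>f y - g N y\<bar> \<le> \<epsilon>" if "y \<in> U" "y \<in> ?E" for y
      proof (rule LIMSEQ_le_const2)
        show "(\<lambda>i. \<bar>g i y - g N y\<bar>) \<longlonglongrightarrow> \<bar>f y - g N y\<bar>" by (intro tendsto_intros lim)
        show "\<exists>M. \<forall>i\<ge>M. \<bar>g i y - g N y\<bar> \<le> \<epsilon>" using diff that by blast
      qed
      let ?A' = "{y. g N y \<le> of_rat p'}" and ?B' = "{y. g N y \<ge> of_rat q'}"
      have "p' < q'" using q'(1) by (simp add: of_rat_less)
      then have "sep_rank ?A' ?B' \<le> ?k" using sep_rank_le_alpha1 g order_trans by blast
      then obtain \<mu> F where F: "\<mu> \<le> ?k" "diff_seq \<mu> F" "separates \<mu> F ?A' ?B'"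
        using k(2) by (rule sep_rank_leE)
      have "altseq ?A ?B ?b \<inter> U \<inter> ?A \<subseteq> ?A'" "altseq ?A ?B ?b \<inter> U \<inter> ?B \<subseteq> ?B'"
        using close Suc p' q' by fastforce+
      then have "altseq ?A ?B (?b + ?k) \<inter> U \<subseteq> F ?k"
        by (rule altseq_add_subset[OF F(2,3) U(1) limit_stage])
      \<comment> \<open>The separating sequence for \<open>g N\<close> has length at most
        \<open>\<omega>\<^sup>l\<close>, so its set at that index is empty.\<close>
      then show False using x U(2) F(1,2) by (auto simp: diff_seq_def)
    qed
  qed simp
  have "deriv_rank ?D \<le> gamma_rank g"
    unfolding gamma_rank_def using \<epsilon>(1)
    by (intro cSUP_upper bdd_aboveI[where M = omega1]) (auto simp: deriv_rank_le_omega1)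
  also have "\<dots> \<le> omega" using conv by (simp add: pseudouniformly_convergent_def)
  finally have rank: "deriv_rank ?D \<le> omega" .
  \<comment> \<open>A rank at most \<open>omega\<close> is below the default \<open>omega1\<close>,
    so the derivatives do become empty.\<close>
  then have "\<exists>\<theta>. iter_deriv ?D \<theta> UNIV = {}"
    using omega_less_omega1 unfolding deriv_rank_def by (auto split: if_splits)
  then have "iter_deriv ?D (LEAST \<theta>. iter_deriv ?D \<theta> UNIV = {}) UNIV = {}" by (rule LeastI_ex)
  moreover have "(LEAST \<theta>. iter_deriv ?D \<theta> UNIV = {}) \<le> omega"
    using rank omega_less_omega1 unfolding deriv_rank_def by (auto split: if_splits)
  ultimately obtain \<theta> where \<theta>: "iter_deriv ?D \<theta> UNIV = {}" "\<theta> \<le> omega" by blast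
  have "altseq ?A ?B (?k * omega) = {}"
  proof (rule ccontr)
    assume "altseq ?A ?B (?k * omega) \<noteq> {}"
    then obtain x where x: "x \<in> altseq ?A ?B (?k * omega)" by blast
    have mem: "x \<in> iter_deriv ?D (ord_of_nat m) UNIV" for m
    proof -
      have "?k * ord_of_nat m \<le> ?k * omega"
        using times_nat_add_less_times_omega[OF opow_omega_pos, of l m] by simp
      then show ?thesis using x main altseq_antimono by blast
    qed
    then have "x \<in> iter_deriv ?D omega UNIV"
      using is_limit_omega by (auto elim!: less_omegaE)
    then show False using \<theta> mem by (metis empty_iff less_omegaE order_le_less)
  qed
  then show "sep_rank ?A ?B \<le> omega ^\<^sub>o osucc l"
    using is_limit_times_omega[OF opow_omega_pos] times_omega_less_omega1[OF k(2)]
    by (simp add: sep_rank_le_if_altseq_empty)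
qed

section \<open>Identification of the levels by induction\<close>

theorem theorem4p3:
  fixes lam :: ordinal
  assumes "uncountable (UNIV :: 'a::polish_space set)"
    and "lam < omega1"
  shows "(Phi_level lam :: ('a \<Rightarrow> real) set) = bounded_baire1 (lam + 1)"
  using assms(2)
proof (induction lam rule: less_induct)
  case (less l)
  show ?case
  proof (cases "l = 0")
    case True
    then show ?thesis by (simp add: Phi_level.simps)
  next
    case False
    then have pos: "0 < l" by (simp add: ord_zero_less_iff)
    let ?C = "\<Union>\<eta>\<in>{..<l}. Phi_level \<eta> :: ('a \<Rightarrow> real) set"
    have level: "Phi_level \<eta> = (bounded_baire1 (osucc \<eta>) :: ('a \<Rightarrow> real) set)" if "\<eta> < l" for \<eta>
      using less that by (simp add: osucc_eq_plus_1)
    have "Phi ?C = bounded_baire1 (osucc l)"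
    proof (intro equalityI subsetI)
      fix f :: "'a \<Rightarrow> real" assume "f \<in> Phi ?C"
      then obtain g where f: "baire1 f" "bounded (range f)" and g: "\<And>k. g k \<in> ?C"
        and conv: "pseudouniformly_convergent g" and lim: "\<And>x. (\<lambda>k. g k x) \<longlonglongrightarrow> f x"
        unfolding Phi_def by blast
      have "alpha1 (g k) \<le> omega ^\<^sub>o l" for k
      proof -
        obtain \<eta> where \<eta>: "\<eta> < l" "g k \<in> bounded_baire1 (osucc \<eta>)" using g[of k] level by blast
        then have "alpha1 (g k) \<le> omega ^\<^sub>o osucc \<eta>" by (simp add: bounded_baire1_def)
        \<comment> \<open>The exponent \<open>osucc \<eta>\<close> is at most \<open>l\<close>, so
          all members of the sequence share the bound \<open>\<omega>\<^sup>l\<close>.\<close>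
        also have "\<dots> \<le> omega ^\<^sub>o l" using \<eta>(1) by (intro opow_omega_le) (simp add: osucc_le_iff)
        finally show ?thesis .
      qed
      then have "alpha1 f \<le> omega ^\<^sub>o osucc l"
        using conv lim pos less.prems by (rule Phi_alpha1_le)
      then show "f \<in> bounded_baire1 (osucc l)" using f by (simp add: bounded_baire1_def)
    next
      fix f :: "'a \<Rightarrow> real" assume f: "f \<in> bounded_baire1 (osucc l)"
      obtain g \<eta> where seq: "(\<forall>k. \<eta> k < l) \<and> (\<forall>k. g k \<in> bounded_baire1 (osucc (\<eta> k))) \<and>
          (\<forall>\<epsilon>>0. \<exists>n. settles \<epsilon> n g f)"
        using bounded_baire1_settles[OF f pos less.prems] by (elim exE)
      then have g: "\<And>k. \<eta> k < l" "\<And>k. g k \<in> bounded_baire1 (osucc (\<eta> k))"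
        "\<And>\<epsilon>. 0 < \<epsilon> \<Longrightarrow> \<exists>n. settles \<epsilon> n g f"
        by blast+
      have "g k \<in> ?C" for k using g(1,2)[of k] level by blast
      then show "f \<in> Phi ?C"
        using f settles_imp_pseudouniformly_convergent[OF g(3)] settles_imp_tendsto[OF g(3)]
        unfolding Phi_def bounded_baire1_def by blast
    qed
    then show ?thesis using False by (subst Phi_level.simps) (simp add: osucc_eq_plus_1)
  qed
qed

end
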